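(* Let $t\in\mathbb{C}\setminus S(\Lambda)$. Then $t$ is an eigenvalue of the operator $Z_-:\mathcal{H}(\Lambda)\to\mathcal{H}(\Lambda)$. The corresponding eigenspace is one-dimensional; it is spanned by the DA function $e_t$ determined as follows: $e_t(0)=1$, and for $z\in V(\Lambda)$, $z\neq0$, $$e_t(z)=\prod_{k=1}^N\frac{2+t(1+z_k-z_{k-1})}{2+t(1+z_{k-1}-z_k)},$$ where $(z_0,z_1,\dots,z_N)$ is any path in $\Lambda$ from $z_0=0$ to $z_N=z$.
   Context: **Lattice.** $\Lambda$ is a rhombic lattice in the complex plane $\mathbb{C}$: a monohedral (all tiles congruent), edge-to-edge tessellation of $\mathbb{C}$ with rhombi of side length $1$. $V(\Lambda)$, $E(\Lambda)$ denote its sets of vertices and edges; $(a,b)\in E(\Lambda)$ means that $a,b\in V(\Lambda)$ are adjacent, and edges are taken in both orientations, so $(a,b)\in E(\Lambda)$ iff $(b,a)\in E(\Lambda)$. A path in $\Lambda$ from $a$ to $b$ is a finite sequence $(z_0,\dots,z_N)$ of vertices with $z_0=a$, $z_N=b$ and $z_{n-1},z_n$ adjacent for $n=1,\dots,N$; it is closed if $a=b$. Standing assumptions on $\Lambda$: (i) $0\in V(\Lambda)$; (ii) for every $z\in V(\Lambda)$ there are $N\in\mathbb{N}$ and a path $(z_0,\dots,z_N)$ with $z_0=z$, $z_n-z_{n-1}\neq\pm1$ for $n=1,\dots,N-1$, and $z_N-z_{N-1}=1$. **Discrete analyticity.** For $f:V(\Lambda)\to\mathbb{C}$ and a path $\gamma=(z_0,\dots,z_N)$,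 $\int_\gamma f\,\delta z=\sum_{n=1}^N\frac{f(z_{n-1})+f(z_n)}{2}(z_n-z_{n-1})$. $f$ is discrete analytic (DA) if $\int_\gamma f\,\delta z=0$ for every closed path $\gamma$; then $\int_a^b f\,\delta z$ denotes $\int_\gamma f\,\delta z$ for any path $\gamma$ from $a$ to $b$. $\mathcal{H}(\Lambda)$ is the complex vector space of DA functions on $V(\Lambda)$. **Shift operators.** $Z_+:\mathcal{H}(\Lambda)\to\mathcal{H}(\Lambda)$ is $(Z_+f)(z)=\frac{f(0)-f(z)}{2}+\int_0^z f\,\delta z$. It is injective with range $\{g\in\mathcal{H}(\Lambda):g(0)=0\}$, so one may define $Z_-:\mathcal{H}(\Lambda)\to\mathcal{H}(\Lambda)$ by letting $Z_-f$ be the unique element of $\mathcal{H}(\Lambda)$ with $(Z_+Z_-f)(z)=f(z)-f(0)$. **The set $S(\Lambda)$.** $S(\Lambda)=\{t\in\mathbb{C}: t(1+b-a)=-2\text{ for some }(a,b)\in E(\Lambda)\}$. *)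

theory Defs
  imports "HOL-Analysis.Analysis" "HOL-Library.Function_Algebras"
begin

subsection \<open>Rhombic lattices\<close>

definition unit_rhombus :: "complex set \<Rightarrow> bool" where
  "unit_rhombus R \<longleftrightarrow>
     (\<exists>p u v. norm u = 1 \<and> norm v = 1 \<and> independent {u, v} \<and> u \<noteq> v \<and>
        R = convex hull {p, p + u, p + u + v, p + v})"

definition congruent_sets :: "complex set \<Rightarrow> complex set \<Rightarrow> bool" where
  "congruent_sets R R' \<longleftrightarrow>
     (\<exists>f. (\<forall>x y. dist (f x) (f y) = dist x y) \<and> f ` R = R')"

text \<open>A lattice is given by its set of tiles. The faces of a rhombus are the empty set, its
  vertices (as singletons), its closed edges and the rhombus itself, so, interiors being
  disjoint, the last clause says that distinct tiles meet in nothing, in a common vertex, or in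
  a common full edge.\<close>

definition rhombic_lattice :: "complex set set \<Rightarrow> bool" where
  "rhombic_lattice \<Lambda> \<longleftrightarrow>
     (\<forall>R\<in>\<Lambda>. unit_rhombus R) \<and>
     (\<forall>R\<in>\<Lambda>. \<forall>R'\<in>\<Lambda>. congruent_sets R R') \<and>
     \<Union>\<Lambda> = UNIV \<and>
     (\<forall>R\<in>\<Lambda>. \<forall>R'\<in>\<Lambda>. R \<noteq> R' \<longrightarrow> interior R \<inter> interior R' = {}) \<and>
     (\<forall>R\<in>\<Lambda>. \<forall>R'\<in>\<Lambda>. R \<noteq> R' \<longrightarrow> (R \<inter> R') face_of R \<and> (R \<inter> R') face_of R')"

definition verts :: "complex set set \<Rightarrow> complex set" where
  "verts \<Lambda> = {z. \<exists>R\<in>\<Lambda>. z extreme_point_of R}"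

text \<open>Oriented edges. A pair \<open>(a, a)\<close> never occurs, since an edge has affine dimension 1.\<close>

definition edges :: "complex set set \<Rightarrow> (complex \<times> complex) set" where
  "edges \<Lambda> = {(a, b). \<exists>R\<in>\<Lambda>. closed_segment a b edge_of R}"

text \<open>The path \<open>(z 0, \<dots>, z N)\<close>; the values of \<open>z\<close> beyond \<open>N\<close> are irrelevant.\<close>

definition is_path ::
    "complex set set \<Rightarrow> nat \<Rightarrow> (nat \<Rightarrow> complex) \<Rightarrow> complex \<Rightarrow> complex \<Rightarrow> bool" where
  "is_path \<Lambda> N z a b \<longleftrightarrow>
     z 0 = a \<and> z N = b \<and> (\<forall>n\<le>N. z n \<in> verts \<Lambda>) \<and>
     (\<forall>n\<in>{1..N}. (z (n - 1), z n) \<in> edges \<Lambda>)"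

subsection \<open>Discrete analytic functions\<close>

definition path_integral :: "nat \<Rightarrow> (nat \<Rightarrow> complex) \<Rightarrow> (complex \<Rightarrow> complex) \<Rightarrow> complex" where
  "path_integral N z f = (\<Sum>n=1..N. (f (z (n - 1)) + f (z n)) / 2 * (z n - z (n - 1)))"

text \<open>A function on \<open>verts \<Lambda>\<close> is represented by its extension by zero to the plane, so that
  pointwise operations on such functions remain such functions and equality is equality
  on \<open>verts \<Lambda>\<close>.\<close>

definition DA :: "complex set set \<Rightarrow> (complex \<Rightarrow> complex) set" where
  "DA \<Lambda> = {f. (\<forall>z. z \<notin> verts \<Lambda> \<longrightarrow> f z = 0) \<and>
              (\<forall>N z a. is_path \<Lambda> N z a a \<longrightarrow> path_integral N z f = 0)}"

text \<open>The common value of the integrals along paths from \<open>a\<close> to \<open>b\<close>, for \<open>f \<in> DA \<Lambda>\<close>.\<close>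

definition DA_integral ::
    "complex set set \<Rightarrow> complex \<Rightarrow> complex \<Rightarrow> (complex \<Rightarrow> complex) \<Rightarrow> complex" where
  "DA_integral \<Lambda> a b f = (THE w. \<exists>N z. is_path \<Lambda> N z a b \<and> w = path_integral N z f)"

definition fun_scale :: "complex \<Rightarrow> (complex \<Rightarrow> complex) \<Rightarrow> (complex \<Rightarrow> complex)" where
  "fun_scale c f = (\<lambda>z. c * f z)"

global_interpretation cfun: vector_space fun_scale
  by unfold_locales (auto simp: fun_scale_def fun_eq_iff algebra_simps)

subsection \<open>Shift operators\<close>

definition Z_plus :: "complex set set \<Rightarrow> (complex \<Rightarrow> complex) \<Rightarrow> (complex \<Rightarrow> complex)" where
  "Z_plus \<Lambda> f =
     (\<lambda>z. if z \<in> verts \<Lambda> then (f 0 - f z) / 2 + DA_integral \<Lambda> 0 z f else 0)"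

definition Z_minus :: "complex set set \<Rightarrow> (complex \<Rightarrow> complex) \<Rightarrow> (complex \<Rightarrow> complex)" where
  "Z_minus \<Lambda> f =
     (THE g. g \<in> DA \<Lambda> \<and> (\<forall>z\<in>verts \<Lambda>. Z_plus \<Lambda> g z = f z - f 0))"

definition eigenspace ::
    "(complex \<Rightarrow> complex) set \<Rightarrow> ((complex \<Rightarrow> complex) \<Rightarrow> (complex \<Rightarrow> complex)) \<Rightarrow>
     complex \<Rightarrow> (complex \<Rightarrow> complex) set" where
  "eigenspace H A t = {f \<in> H. A f = fun_scale t f}"

definition is_eigenvalue ::
    "(complex \<Rightarrow> complex) set \<Rightarrow> ((complex \<Rightarrow> complex) \<Rightarrow> (complex \<Rightarrow> complex)) \<Rightarrow>
     complex \<Rightarrow> bool" where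
  "is_eigenvalue H A t \<longleftrightarrow> (\<exists>f\<in>H. f \<noteq> 0 \<and> A f = fun_scale t f)"

definition S_set :: "complex set set \<Rightarrow> complex set" where
  "S_set \<Lambda> = {t. \<exists>(a, b)\<in>edges \<Lambda>. t * (1 + b - a) = -2}"

definition path_prod :: "complex \<Rightarrow> nat \<Rightarrow> (nat \<Rightarrow> complex) \<Rightarrow> complex" where
  "path_prod t N z =
     (\<Prod>k=1..N. (2 + t * (1 + z k - z (k - 1))) / (2 + t * (1 + z (k - 1) - z k)))"

definition e_fun :: "complex set set \<Rightarrow> complex \<Rightarrow> complex \<Rightarrow> complex" where
  "e_fun \<Lambda> t =
     (\<lambda>z. if z \<notin> verts \<Lambda> then 0 else if z = 0 then 1
          else (THE w. \<exists>N \<gamma>. is_path \<Lambda> N \<gamma> 0 z \<and> w = path_prod t N \<gamma>))"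

end

theory Submission
  imports Defs
begin

text \<open>Write \<open>d\<close> for the difference \<open>b - a\<close> along an edge \<open>(a, b)\<close>. On every edge the equation
  \<open>Z_plus \<Lambda> g = h - h 0\<close> reads \<open>2 (h b - h a) = (g a - g b) + (g a + g b) d\<close>; conversely this
  relation makes \<open>h + g / 2\<close> a primitive of \<open>g\<close>, so that \<open>g\<close> is discrete analytic. For
  \<open>g = t h\<close> it becomes \<open>h b (2 + t (1 - d)) = h a (2 + t (1 + d))\<close>, and for \<open>t\<close> outside
  \<open>S_set \<Lambda>\<close> both factors are nonzero. The eigenfunctions are therefore exactly the functions
  that are multiplied by \<open>(2 + t (1 + d)) / (2 + t (1 - d))\<close> along each edge. Around a rhombus
  these factors cancel in pairs, and the connectedness of the graph makes the eigenspace at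
  most one-dimensional.

  Three facts remain. The first is that a transport of values along edges which is trivial around
  every tile has a global solution (\<open>potential_exists\<close>). This is a monodromy argument: near each
  point all tiles have a common corner (\<open>star_exists\<close>), the values at these corners form a
  system of germs, and such a system has global sections on the plane (\<open>global_section\<close>), by
  bisecting rectangles. The transports are arbitrary maps, so the same statement yields primitives,
  the exponentials, and the two auxiliary objects below.

  The second is that \<open>Z_plus\<close> is injective: a solution \<open>g\<close> is determined at a vertex from which an edge
  of direction 1 leaves, and then along all edges of direction other than \<open>1\<close> and \<open>-1\<close>; by
  the escape condition this reaches every vertex (\<open>shift_rel_unique\<close>).

  The third is that \<open>Z_plus\<close> is onto the functions vanishing at 0 (\<open>Z_plus_surjective\<close>). It is
  needed because a function \<open>h\<close> in the eigenspace is only known to satisfy an equation for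
  \<open>Z_minus \<Lambda> h\<close>, which says something about \<open>h\<close> only if a preimage exists. The edge relation
  degenerates for \<open>d = 1\<close> and \<open>d = -1\<close>. Replacing the coefficient of \<open>g a - g b\<close> by a real
  \<open>c > 1\<close> removes the degeneracy, and there is a solution vanishing at a given vertex \<open>w\<close>. As
  \<open>c\<close> tends to 1, the step from \<open>a\<close> to \<open>b\<close> has a limit unless \<open>d = 1\<close>, so the solutions converge
  at every vertex that can be reached from \<open>w\<close> without steps of direction 1.
  To see that these vertices exhaust the graph as \<open>w\<close> moves to the right, count the strips of tiles
  with edges of direction 1 (the tracks) that separate a vertex from a base vertex, with sign: this
  is the level, the potential of the form that is \<open>1\<close> on steps \<open>1\<close>, \<open>-1\<close> on steps \<open>-1\<close> and 0 otherwise.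
  Interpolated affinely on tiles, it is nondecreasing along horizontal lines, and strictly increasing
  where it is not an integer. All tiles being congruent, a track crosses every horizontal line; hence
  two tracks of the same level coincide (\<open>track_unique\<close>), and vertices of the same level are
  connected by steps other than \<open>1\<close> and \<open>-1\<close> (\<open>same_level_connected\<close>).\<close>

section \<open>Unit rhombi\<close>

text \<open>The parallelogram with corner \<open>p\<close> and side vectors \<open>u\<close>, \<open>v\<close>.\<close>

definition para :: "complex \<Rightarrow> complex \<Rightarrow> complex \<Rightarrow> complex set" where
  "para p u v = convex hull {p, p + u, p + u + v, p + v}"

text \<open>The pair \<open>u\<close>, \<open>v\<close> consists of side vectors of a unit rhombus. The number \<open>Im (cnj u * v)\<close> is the determinant of \<open>u\<close>
  and \<open>v\<close>, so its being nonzero is linear independence over the reals.\<close>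

definition unit_frame :: "complex \<Rightarrow> complex \<Rightarrow> bool" where
  "unit_frame u v \<longleftrightarrow> norm u = 1 \<and> norm v = 1 \<and> Im (cnj u * v) \<noteq> 0"

lemma unit_frame_Im: "unit_frame u v \<Longrightarrow> Im (cnj u * v) \<noteq> 0"
  by (simp add: unit_frame_def)

lemma unit_frame_commute: "unit_frame u v \<longleftrightarrow> unit_frame v u"
  by (auto simp: unit_frame_def mult.commute)

lemma unit_frame_minus: "unit_frame (- u) v \<longleftrightarrow> unit_frame u v"
  by (auto simp: unit_frame_def)

lemma para_commute: "para p u v = para p v u"
  unfolding para_def by (rule arg_cong[of _ _ "\<lambda>S. convex hull S"]) (auto simp: algebra_simps)

text \<open>With \<open>para_commute\<close>, this moves the base point to any of the four corners, so that facts
  about one corner or one side carry over to the others.\<close>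

lemma para_shift: "para (p + u) (- u) v = para p u v"
  unfolding para_def by (rule arg_cong[of _ _ "\<lambda>S. convex hull S"]) (auto simp: algebra_simps)

lemma independent_imp_Im:
  fixes u v :: complex
  assumes "norm u = 1" "independent {u, v}" "u \<noteq> v"
  shows "Im (cnj u * v) \<noteq> 0"
proof
  assume "Im (cnj u * v) = 0"
  then obtain r where r: "cnj u * v = of_real r"
    by (metis complex_is_Real_iff Reals_cases)
  have "u * cnj u = 1"
    using assms(1) by (simp add: complex_norm_square[symmetric])
  then have "v = of_real r * u"
    using r by (metis mult.assoc mult.commute mult_1)
  then have "v \<in> span {u}"
    by (simp add: scaleR_conv_of_real[symmetric] span_base span_scale)
  moreover have "v \<notin> span {u}"
    using assms(2,3) independent_insert[of v "{u}"] by (simp add: insert_commute)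
  ultimately show False by simp
qed

lemma unit_rhombus_para:
  assumes "unit_rhombus R"
  obtains p u v where "R = para p u v" "unit_frame u v"
  using assms independent_imp_Im unfolding unit_rhombus_def para_def unit_frame_def by metis

lemma frame_coords_unique:
  assumes "Im (cnj u * v) \<noteq> 0"
    and "of_real s * u + of_real t * v = of_real s' * u + of_real t' * v"
  shows "s = s'" "t = t'"
proof -
  have "Im (cnj u * (of_real s * u + of_real t * v)) = Im (cnj u * (of_real s' * u + of_real t' * v))"
    "Im (cnj v * (of_real s * u + of_real t * v)) = Im (cnj v * (of_real s' * u + of_real t' * v))"
    using assms(2) by simp_all
  then have "(t - t') * Im (cnj u * v) = 0" "(s - s') * Im (cnj u * v) = 0"
    by (simp_all add: algebra_simps)
  then show "s = s'" "t = t'" using assms(1) by auto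
qed

lemma frame_coords_exist:
  assumes "Im (cnj u * v) \<noteq> 0"
  shows "x = of_real (Im (cnj v * x) / Im (cnj v * u)) * u + of_real (Im (cnj u * x) / Im (cnj u * v)) * v"
proof -
  have *: "Im (cnj v * u) = - Im (cnj u * v)" by simp
  define D where "D = Im (cnj u * v)"
  have D: "D \<noteq> 0" using assms D_def by simp
  have D': "D = Re u * Im v - Im u * Re v" by (simp add: D_def)
  show ?thesis unfolding * D_def[symmetric] using D
    by (simp add: complex_eq_iff field_simps) (simp add: D' algebra_simps)
qed

lemma mem_para:
  assumes "Im (cnj u * v) \<noteq> 0"
  shows "x \<in> para p u v \<longleftrightarrow>
    (\<exists>s t. 0 \<le> s \<and> s \<le> 1 \<and> 0 \<le> t \<and> t \<le> 1 \<and> x = p + (of_real s * u + of_real t * v))"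
proof
  let ?Q = "{x. \<exists>s t. 0 \<le> s \<and> s \<le> 1 \<and> 0 \<le> t \<and> t \<le> 1 \<and> x = p + (of_real s * u + of_real t * v)}"
  have "convex ?Q"
    unfolding convex_alt
  proof clarsimp
    fix s t s' t' l :: real
    assume *: "0 \<le> s" "0 \<le> s'" "0 \<le> t" "0 \<le> t'" "s \<le> 1" "s' \<le> 1" "t \<le> 1" "t' \<le> 1" "0 \<le> l" "l \<le> 1"
    have c: "0 \<le> (1-l)*a + l*b" "(1-l)*a + l*b \<le> 1" if "0 \<le> a" "a \<le> 1" "0 \<le> b" "b \<le> 1" for a b :: real
      using that * convex_bound_le[of a 1 b "1-l" l] by auto
    show "\<exists>sa. 0 \<le> sa \<and> sa \<le> 1 \<and> (\<exists>ta\<ge>0. ta \<le> 1 \<and>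
        (1 - l) *\<^sub>R (p + (of_real s * u + of_real t * v)) + l *\<^sub>R (p + (of_real s' * u + of_real t' * v)) =
        p + (complex_of_real sa * u + complex_of_real ta * v))"
      by (rule exI[of _ "(1-l) * s+l * s'"], intro conjI c * exI[of _ "(1-l) * t + l * t'"])
        (simp add: scaleR_conv_of_real algebra_simps)
  qed
  moreover have "p \<in> ?Q" by (auto intro!: exI[of _ 0])
  moreover have "p + u \<in> ?Q" by (rule CollectI, rule exI[of _ 1], rule exI[of _ 0]) simp
  moreover have "p + v \<in> ?Q" by (rule CollectI, rule exI[of _ 0], rule exI[of _ 1]) simp
  moreover have "p + u + v \<in> ?Q" by (auto intro!: exI[of _ 1])
  ultimately have "para p u v \<subseteq> ?Q"
    unfolding para_def by (intro hull_minimal) auto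
  then show "x \<in> para p u v \<Longrightarrow> \<exists>s t. 0 \<le> s \<and> s \<le> 1 \<and> 0 \<le> t \<and> t \<le> 1 \<and> x = p + (of_real s * u + of_real t * v)"
    by blast
next
  assume "\<exists>s t. 0 \<le> s \<and> s \<le> 1 \<and> 0 \<le> t \<and> t \<le> 1 \<and> x = p + (of_real s * u + of_real t * v)"
  then obtain s t where st: "0 \<le> s" "s \<le> 1" "0 \<le> t" "t \<le> 1" "x = p + (of_real s * u + of_real t * v)" by blast
  have c: "convex (para p u v)" by (simp add: para_def)
  have inc: "p \<in> para p u v" "p + u \<in> para p u v" "p + u + v \<in> para p u v" "p + v \<in> para p u v"
    unfolding para_def by (auto intro: hull_inc)
  have "(1-s) *\<^sub>R p + s *\<^sub>R (p+u) \<in> para p u v" "(1-s) *\<^sub>R (p+v) + s *\<^sub>R (p+u+v) \<in> para p u v"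
    by (rule convexD[OF c]; use inc st in simp)+
  then have "(1-t) *\<^sub>R ((1-s) *\<^sub>R p + s *\<^sub>R (p+u)) + t *\<^sub>R ((1-s) *\<^sub>R (p+v) + s *\<^sub>R (p+u+v)) \<in> para p u v"
    by (rule convexD[OF c]) (use st in simp_all)
  moreover have "(1-t) *\<^sub>R ((1-s) *\<^sub>R p + s *\<^sub>R (p+u)) + t *\<^sub>R ((1-s) *\<^sub>R (p+v) + s *\<^sub>R (p+u+v)) = x"
    by (simp add: st(5) scaleR_conv_of_real algebra_simps)
  ultimately show "x \<in> para p u v" by simp
qed

lemma side_face_of_para:
  assumes "Im (cnj u * v) \<noteq> 0"
  shows "closed_segment p (p + u) face_of para p u v"
  unfolding face_of_def
proof (intro conjI ballI impI)
  show "closed_segment p (p + u) \<subseteq> para p u v"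
    unfolding para_def by (intro closed_segment_subset_convex_hull hull_inc) auto
  fix a b x
  assume a: "a \<in> para p u v" and b: "b \<in> para p u v" and x: "x \<in> closed_segment p (p + u)"
    and xo: "x \<in> open_segment a b"
  obtain s t where st: "0 \<le> s" "s \<le> 1" "0 \<le> t" "t \<le> 1" "a = p + (of_real s * u + of_real t * v)"
    using a mem_para[OF assms] by auto
  obtain s' t' where st': "0 \<le> s'" "s' \<le> 1" "0 \<le> t'" "t' \<le> 1" "b = p + (of_real s' * u + of_real t' * v)"
    using b mem_para[OF assms] by auto
  obtain r where r: "x = (1-r) *\<^sub>R p + r *\<^sub>R (p+u)" using x by (auto simp: in_segment)
  obtain l where l: "0 < l" "l < 1" "x = (1-l) *\<^sub>R a + l *\<^sub>R b" using xo by (auto simp: in_segment)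
  have "of_real r * u + of_real 0 * v = of_real ((1-l) * s+l * s') * u + of_real ((1-l) * t + l * t') * v"
    using r l(3) unfolding st(5) st'(5) by (simp add: scaleR_conv_of_real algebra_simps)
  from frame_coords_unique(2)[OF assms this] have "(1-l) * t + l * t' = 0" by simp
  moreover have "0 \<le> (1-l)*t" "0 \<le> l*t'" using l st st' by simp_all
  ultimately have "(1-l)*t = 0" "l*t' = 0" by linarith+
  then have t0: "t = 0" "t' = 0" using l by simp_all
  show "a \<in> closed_segment p (p+u)" "b \<in> closed_segment p (p+u)"
    unfolding in_segment using st st' t0
    by (auto simp: scaleR_conv_of_real algebra_simps intro: exI[of _ s] exI[of _ s'])
qed simp

lemma para_corner_extreme:
  assumes "Im (cnj u * v) \<noteq> 0"
  shows "p extreme_point_of para p u v"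
proof -
  have "p extreme_point_of closed_segment p (p+u)" by (simp add: extreme_point_of_segment)
  then show ?thesis using extreme_point_of_face[OF side_face_of_para[OF assms]] by blast
qed

lemma extreme_point_of_para:
  assumes "unit_frame u v"
  shows "x extreme_point_of para p u v \<longleftrightarrow> x \<in> {p, p + u, p + u + v, p + v}"
proof
  assume "x extreme_point_of para p u v"
  then show "x \<in> {p, p + u, p + u + v, p + v}"
    unfolding para_def by (rule extreme_point_of_convex_hull)
next
  have D: "Im (cnj u * v) \<noteq> 0" using assms by (simp add: unit_frame_def)
  have 1: "(p + u) extreme_point_of para p u v"
    using para_corner_extreme[of "-u" v "p+u"] D by (simp add: para_shift)
  have 2: "(p + v) extreme_point_of para p u v"
  proof -
    have "Im (cnj (- v) * u) \<noteq> 0" using D by (auto simp: algebra_simps)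
    from para_corner_extreme[OF this, of "p+v"] show ?thesis
      using para_shift[of p v u] by (simp add: para_commute[of p u v])
  qed
  have 3: "(p + u + v) extreme_point_of para p u v"
    using para_corner_extreme[of "-u" "-v" "p+u+v"] D
    by (metis (no_types, lifting) add.assoc add.commute complex_cnj_minus minus_mult_minus para_commute para_shift)
  show "x extreme_point_of para p u v" if "x \<in> {p, p + u, p + u + v, p + v}"
    using that 1 2 3 para_corner_extreme[OF D] by blast
qed

text \<open>Every corner of a rhombus can serve as its base point.\<close>

lemma rebase_para:
  assumes "unit_rhombus R" "a extreme_point_of R"
  obtains u v where "R = para a u v" "unit_frame u v"
proof -
  obtain p u v where R: "R = para p u v" and f: "unit_frame u v"
    using unit_rhombus_para[OF assms(1)] .
  have "a \<in> {p, p + u, p + u + v, p + v}" using assms(2) extreme_point_of_para[OF f] R by simp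
  then consider "a = p" | "a = p + u" | "a = p + v" | "a = p + u + v" by blast
  then show thesis
  proof cases
    case 1 then show ?thesis using that R f by blast
  next
    case 2 then show ?thesis using that[of "-u" v] R f by (simp add: para_shift unit_frame_minus)
  next
    case 3 then show ?thesis using that[of "-v" u] R f
      by (simp add: para_shift unit_frame_minus para_commute[of p u v] unit_frame_commute[of u])
  next
    case 4
    have "para (p+u+v) (-v) (-u) = para p u v"
      by (metis para_commute para_shift)
    then show ?thesis using that[of "-v" "-u"] R f 4
      by (metis unit_frame_minus unit_frame_commute)
  qed
qed

lemma para_midpoint_interior:
  assumes "Im (cnj u * v) \<noteq> 0"
  shows "p + (u + v) / 2 \<in> interior (para p u v)"
proof (rule interiorI)
  let ?s = "\<lambda>x. Im (cnj v * (x-p)) / Im (cnj v * u)" and ?t = "\<lambda>x. Im (cnj u * (x-p)) / Im (cnj u * v)"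
  let ?U = "{x. 0 < ?s x} \<inter> {x. ?s x < 1} \<inter> {x. 0 < ?t x} \<inter> {x. ?t x < 1}"
  have D: "Im (cnj v * u) \<noteq> 0" using assms by (simp add: mult.commute)
  show "open ?U"
    using D assms by (intro open_Int open_Collect_less continuous_intros) auto
  show "?U \<subseteq> para p u v"
  proof
    fix x assume x: "x \<in> ?U"
    have "x = p + (of_real (?s x) * u + of_real (?t x) * v)"
      using frame_coords_exist[OF assms, of "x - p"] by (metis add_diff_cancel_left' diff_add_cancel add.commute)
    with x show "x \<in> para p u v" unfolding mem_para[OF assms]
      by (intro exI[of _ "?s x"] exI[of _ "?t x"]) auto
  qed
  have *: "Im (cnj v * v) = 0" "Im (cnj u * u) = 0" by simp_all
  have e: "p + (u+v)/2 - p = of_real (1/2) * u + of_real (1/2) * v" by (simp add: field_simps)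
  have "?s (p + (u+v)/2) = 1/2"
    unfolding e using D by (simp add: field_simps)
  moreover have "?t (p + (u+v)/2) = 1/2"
    unfolding e using assms by (simp add: field_simps)
  ultimately show "p + (u+v)/2 \<in> ?U" by (simp only: Int_iff mem_Collect_eq) auto
qed

text \<open>A face containing a diagonal contains the centre, which is an interior point.\<close>

lemma face_with_opposite_corners:
  assumes "Im (cnj u * v) \<noteq> 0" "F face_of para p u v" "p \<in> F" "p + u + v \<in> F"
  shows "F = para p u v"
proof (rule ccontr)
  assume "F \<noteq> para p u v"
  then have "F \<inter> interior (para p u v) = {}" using face_of_disjoint_interior[OF assms(2)] by blast
  moreover have "(1/2) *\<^sub>R p + (1/2) *\<^sub>R (p+u+v) \<in> F"
    by (rule convexD) (use assms face_of_imp_convex in auto)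
  moreover have "(1/2) *\<^sub>R p + (1/2) *\<^sub>R (p+u+v) = p + (u+v)/2"
    by (simp add: scaleR_conv_of_real field_simps)
  ultimately show False using para_midpoint_interior[OF assms(1)] by auto
qed

lemma edge_of_para_base:
  assumes "unit_frame u v"
  shows "closed_segment p (p+u) edge_of para p u v"
proof -
  have "u \<noteq> 0" using assms by (auto simp: unit_frame_def)
  then have "aff_dim (closed_segment p (p+u)) = 1"
    by (simp add: segment_convex_hull aff_dim_convex_hull aff_dim_2)
  then show ?thesis
    using assms side_face_of_para[of u v p] by (simp add: edge_of_def unit_frame_def)
qed

lemma edge_endpoints_extreme:
  assumes "closed_segment a b edge_of R"
  shows "a extreme_point_of R" "b extreme_point_of R" "a \<noteq> b"
proof -
  have f: "closed_segment a b face_of R" and d: "aff_dim (closed_segment a b) = 1"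
    using assms by (auto simp: edge_of_def)
  show "a extreme_point_of R" "b extreme_point_of R"
    using extreme_point_of_face[OF f] by (auto simp: extreme_point_of_segment)
  show "a \<noteq> b" using d by auto
qed

lemma diagonal_not_edge:
  assumes f: "unit_frame u v"
  shows "\<not> closed_segment p (p + u + v) edge_of para p u v"
proof
  assume "closed_segment p (p + u + v) edge_of para p u v"
  then have face: "closed_segment p (p + u + v) face_of para p u v" by (simp add: edge_of_def)
  have D: "Im (cnj u * v) \<noteq> 0" using f by (simp add: unit_frame_def)
  have "closed_segment p (p + u + v) = para p u v"
    by (rule face_with_opposite_corners[OF D face]) auto
  then have "(p + u) extreme_point_of closed_segment p (p + u + v)"
    using extreme_point_of_para[OF f] by simp
  then have "p + u = p \<or> p + u = p + u + v" by (simp add: extreme_point_of_segment)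
  then show False using D by auto
qed

lemma edge_of_para:
  assumes f: "unit_frame u v"
  shows "closed_segment a b edge_of para p u v \<longleftrightarrow>
    (a, b) \<in> {(p, p + u), (p, p + v), (p + u, p + u + v), (p + v, p + u + v),
                (p + u, p), (p + v, p), (p + u + v, p + u), (p + u + v, p + v)}"
    (is "_ \<longleftrightarrow> _ \<in> ?E")
proof
  have nd: "\<not> closed_segment p (p + u + v) edge_of para p u v"
    by (rule diagonal_not_edge[OF f])
  have nd': "\<not> closed_segment (p + u) (p + v) edge_of para p u v"
    using diagonal_not_edge[of "-u" v "p+u"] f by (simp add: unit_frame_minus para_shift)
  assume e: "closed_segment a b edge_of para p u v"
  have "a \<in> {p, p+u, p+u+v, p+v}" "b \<in> {p, p+u, p+u+v, p+v}" "a \<noteq> b"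
    using edge_endpoints_extreme[OF e] extreme_point_of_para[OF f] by simp_all
  moreover have "{a, b} \<noteq> {p, p + u + v}" "{a, b} \<noteq> {p + u, p + v}"
    using e nd nd' by (auto simp: doubleton_eq_iff closed_segment_commute)
  ultimately show "(a, b) \<in> ?E" by (simp add: doubleton_eq_iff) metis
next
  have f': "unit_frame v u" "unit_frame (-u) (-v)" "unit_frame (-v) (-u)"
    using f unit_frame_minus unit_frame_commute by metis+
  have q: "para (p+u+v) (-u) (-v) = para p u v"
    by (metis para_commute para_shift add.assoc add.commute)
  have "closed_segment p (p+u) edge_of para p u v" by (rule edge_of_para_base[OF f])
  moreover have "closed_segment p (p+v) edge_of para p u v"
    using edge_of_para_base[OF f'(1), of p] by (simp add: para_commute)
  moreover have "closed_segment (p+u+v) (p+v) edge_of para p u v"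
    using edge_of_para_base[OF f'(2), of "p+u+v"] by (simp add: q)
  moreover have "closed_segment (p+u+v) (p+u) edge_of para p u v"
    using edge_of_para_base[OF f'(3), of "p+u+v"] q para_commute[of "p+u+v"] by simp
  ultimately show "(a, b) \<in> ?E \<Longrightarrow> closed_segment a b edge_of para p u v"
    by (auto simp: closed_segment_commute)
qed

lemma edge_of_rhombus:
  assumes "unit_rhombus R" "closed_segment a b edge_of R"
  obtains v where "R = para a (b - a) v" "unit_frame (b - a) v"
proof -
  note e = edge_endpoints_extreme[OF assms(2)]
  obtain u v where R: "R = para a u v" and f: "unit_frame u v"
    using rebase_para[OF assms(1) e(1)] .
  have "b \<in> {a, a+u, a+u+v, a+v}" using e(2) R extreme_point_of_para[OF f] by blast
  moreover have "b \<noteq> a + u + v" using assms(2) R diagonal_not_edge[OF f] by blast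
  ultimately consider "b = a + u" | "b = a + v" using e(3) by blast
  then show thesis
  proof cases
    case 1 then show ?thesis using that[of v] R f by simp
  next
    case 2 then show ?thesis using that[of u] R f by (simp add: para_commute unit_frame_commute)
  qed
qed

lemma para_diameter:
  assumes "unit_frame u v" "x \<in> para p u v" "y \<in> para p u v"
  shows "dist x y \<le> 2"
proof -
  have D: "Im (cnj u * v) \<noteq> 0" and n: "norm u = 1" "norm v = 1"
    using assms(1) by (simp_all add: unit_frame_def)
  obtain s t where st: "0 \<le> s" "s \<le> 1" "0 \<le> t" "t \<le> 1" "x = p + (of_real s * u + of_real t * v)"
    using assms(2) mem_para[OF D] by auto
  obtain s' t' where st': "0 \<le> s'" "s' \<le> 1" "0 \<le> t'" "t' \<le> 1" "y = p + (of_real s' * u + of_real t' * v)"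
    using assms(3) mem_para[OF D] by auto
  have "x - y = of_real (s - s') * u + of_real (t - t') * v"
    by (simp add: st(5) st'(5) algebra_simps)
  then have "dist x y \<le> norm (of_real (s - s') * u) + norm (of_real (t - t') * v)"
    by (simp only: dist_norm norm_triangle_ineq)
  also have "\<dots> = \<bar>s - s'\<bar> + \<bar>t - t'\<bar>"
    unfolding norm_mult n norm_of_real by simp
  also have "\<dots> \<le> 2" using st st' by linarith
  finally show ?thesis .
qed

section \<open>Sections of a system of germs on the plane\<close>

text \<open>A section assigns to every point of \<open>S\<close> a germ, such that the germ at \<open>p\<close> determines the
  germs at the points \<open>x\<close> of \<open>S\<close> within distance \<open>r p\<close>, by the restriction map \<open>res p x\<close>.\<close>

definition section_on where
  "section_on r res S F \<longleftrightarrow>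
     (\<forall>p\<in>S. \<forall>x\<in>S. dist p x < r p \<longrightarrow> F x = res p x (F p))"

text \<open>A system of germs on the plane: all stalks are copies of the type \<open>'g\<close>, a germ at \<open>p\<close>
  extends to the disc of radius \<open>r p\<close>, restrictions to nearby points are bijective, and
  restricting in two steps is restricting in one. This is a locally constant sheaf, given by a
  covering with discs.\<close>

locale germ_system =
  fixes r :: "complex \<Rightarrow> real" and res :: "complex \<Rightarrow> complex \<Rightarrow> 'g \<Rightarrow> 'g"
  assumes r_pos: "r p > 0"
    and res_bij: "dist p x < r p \<Longrightarrow> bij (res p x)"
    and res_coherent: "dist p x < r p \<Longrightarrow> dist p y < r p \<Longrightarrow> dist x y < r x
      \<Longrightarrow> res p y s = res x y (res p x s)"
begin

abbreviation "sec \<equiv> section_on r res"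

lemma secD: "sec S F \<Longrightarrow> p \<in> S \<Longrightarrow> x \<in> S \<Longrightarrow> dist p x < r p \<Longrightarrow> F x = res p x (F p)"
  unfolding section_on_def by blast

lemma sec_subset: "sec S F \<Longrightarrow> T \<subseteq> S \<Longrightarrow> sec T F"
  unfolding section_on_def by blast

lemma sec_germ: "(\<And>x. x \<in> S \<Longrightarrow> dist p x < r p) \<Longrightarrow> sec S (\<lambda>y. res p y s)"
  unfolding section_on_def by (intro ballI impI res_coherent)

lemma sec_unique:
  assumes "connected S" "sec S F" "sec S G" "a \<in> S" "b \<in> S" "F a = G a"
  shows "F b = G b"
proof (rule connected_induction_simple[of S a b "\<lambda>x. F x = G x"])
  fix p assume p: "p \<in> S"
  show "\<exists>T. openin (top_of_set S) T \<and> p \<in> T \<and> (\<forall>x\<in>T. \<forall>y\<in>T. F x = G x \<longrightarrow> F y = G y)"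
  proof (intro exI[of _ "S \<inter> ball p (r p)"] conjI ballI impI)
    fix x y assume x: "x \<in> S \<inter> ball p (r p)" and y: "y \<in> S \<inter> ball p (r p)" and e: "F x = G x"
    have "F z = res p z (F p)" "G z = res p z (G p)" if "z \<in> S \<inter> ball p (r p)" for z
      using secD[OF assms(2) p] secD[OF assms(3) p] that by auto
    note * = this
    have "inj (res p x)" using x by (intro bij_is_inj res_bij) simp
    moreover have "res p x (F p) = res p x (G p)" using *[OF x] e by simp
    ultimately have "F p = G p" by (rule injD)
    then show "F y = G y" using *[OF y] by simp
  next
    show "openin (top_of_set S) (S \<inter> ball p (r p))" by (rule openin_open_Int) simp
    show "p \<in> S \<inter> ball p (r p)" using p r_pos by simp
  qed
qed (use assms in simp_all)

text \<open>Only pairs \<open>p\<close>, \<open>x\<close> on different sides need an argument: the segment between them meets the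
  intersection, and the germ at \<open>p\<close> defines a section on the disc around \<open>p\<close> to compare with.\<close>

lemma sec_glue:
  assumes c: "convex S" "convex T" "closed S" "closed T" "convex (S \<union> T)"
    and j: "j \<in> S" "j \<in> T" and F: "sec S F" and G: "sec T G" and e: "F j = G j"
  shows "sec (S \<union> T) (\<lambda>x. if x \<in> S then F x else G x)"
proof -
  have agree: "F x = G x" if "x \<in> S" "x \<in> T" for x
    by (rule sec_unique[OF convex_connected[OF convex_Int[OF c(1,2)]] sec_subset[OF F] sec_subset[OF G], of j])
      (use that j e in simp_all)
  have cross: "G' x = res p x (F' p)"
    if h: "convex S'" "convex T'" "closed S'" "closed T'" "convex (S' \<union> T')" "sec S' F'" "sec T' G'"
      "\<And>z. z \<in> S' \<Longrightarrow> z \<in> T' \<Longrightarrow> F' z = G' z" "p \<in> S'" "x \<in> T'" "dist p x < r p"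
    for S' T' F' G' p x
  proof -
    let ?L = "closed_segment p x"
    have "?L \<subseteq> S' \<union> T'"
      by (rule closed_segment_subset[OF _ _ h(5)]) (simp_all add: h(9,10))
    moreover have "S' \<inter> ?L \<noteq> {}" "T' \<inter> ?L \<noteq> {}" using h(9,10) by auto
    ultimately have "S' \<inter> T' \<inter> ?L \<noteq> {}"
      using connected_closedD[OF connected_segment[of p x], of S' T'] h(3,4) by argo
    then obtain z where z: "z \<in> S'" "z \<in> T'" "z \<in> ?L" by auto
    let ?H = "\<lambda>y. res p y (F' p)"
    have "dist p z \<le> dist p x" using dist_in_closed_segment[OF z(3)] by (simp add: dist_commute)
    then have dz: "dist p z < r p" using h(11) by simp
    have "F' z = ?H z" by (rule secD[OF h(6,9) z(1) dz])
    then have "G' z = ?H z" using h(8) z by auto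
    moreover have "sec (T' \<inter> ball p (r p)) ?H" by (rule sec_germ) auto
    moreover have "sec (T' \<inter> ball p (r p)) G'" using h(7) sec_subset by blast
    moreover have "connected (T' \<inter> ball p (r p))" using h(2) by (intro convex_connected convex_Int) auto
    ultimately show "G' x = ?H x"
      using h(10,11) z(2) dz by (intro sec_unique[of "T' \<inter> ball p (r p)" G' ?H z x]) simp_all
  qed
  show ?thesis
    unfolding section_on_def
  proof (intro ballI impI)
    fix p x assume p: "p \<in> S \<union> T" and x: "x \<in> S \<union> T" and d: "dist p x < r p"
    consider "p \<in> S" "x \<in> S" | "p \<in> S" "x \<in> T" "x \<notin> S" | "p \<in> T" "p \<notin> S" "x \<in> S" | "p \<in> T" "x \<in> T" "p \<notin> S" "x \<notin> S"
      using p x by blast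
    then show "(if x \<in> S then F x else G x) = res p x (if p \<in> S then F p else G p)"
    proof cases
      case 1 then show ?thesis using secD[OF F _ _ d] by simp
    next
      case 2
      then have "G x = res p x (F p)" by (intro cross[OF c F G agree _ _ d])
      then show ?thesis using 2 by simp
    next
      case 3
      have "convex (T \<union> S)" using c(5) by (simp add: Un_commute)
      then have "F x = res p x (G p)"
        using 3 by (intro cross[OF c(2,1,4,3) _ G F agree[symmetric] _ _ d])
      then show ?thesis using 3 by simp
    next
      case 4 then show ?thesis using secD[OF G _ _ d] by simp
    qed
  qed
qed

text \<open>A set is good if germs at each of its points extend to sections on it.\<close>

definition good :: "complex set \<Rightarrow> bool" where
  "good S \<longleftrightarrow> (\<forall>x0\<in>S. \<forall>s0. \<exists>F. sec S F \<and> F x0 = s0)"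

lemma good_union:
  assumes c: "convex S" "convex T" "closed S" "closed T" "convex (S \<union> T)" "S \<inter> T \<noteq> {}"
    and g: "good S" "good T"
  shows "good (S \<union> T)"
proof -
  obtain j where j: "j \<in> S" "j \<in> T" using c by auto
  have main: "\<exists>F. sec (S \<union> T) F \<and> F x0 = s0"
    if h: "convex S" "convex T" "closed S" "closed T" "convex (S \<union> T)" "good S" "good T" "j \<in> S" "j \<in> T" "x0 \<in> S"
    for S T x0 s0
  proof -
    obtain F where F: "sec S F" "F x0 = s0" using h unfolding good_def by blast
    obtain G where G: "sec T G" "G j = F j" using h unfolding good_def by blast
    have "sec (S \<union> T) (\<lambda>x. if x \<in> S then F x else G x)"
      by (rule sec_glue[of S T j F G]) (use h F G in auto)
    then show ?thesis using F(2) h by (intro exI[of _ "\<lambda>x. if x \<in> S then F x else G x"]) auto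
  qed
  show ?thesis
    unfolding good_def
  proof (intro ballI allI)
    fix x0 s0 assume "x0 \<in> S \<union> T"
    then show "\<exists>F. sec (S \<union> T) F \<and> F x0 = s0"
      using main[of S T x0 s0] main[of T S x0 s0] c g j by (auto simp: Un_commute)
  qed
qed

lemma good_small:
  assumes "\<And>x. x \<in> S \<Longrightarrow> dist p x < r p"
  shows "good S"
  unfolding good_def
proof (intro ballI allI)
  fix x0 s0 assume "x0 \<in> S"
  then have "surj (res p x0)" using assms res_bij bij_is_surj by blast
  then obtain s where "res p x0 s = s0" by (metis surjD)
  then show "\<exists>F. sec S F \<and> F x0 = s0" using sec_germ[of S p s] assms by blast
qed

text \<open>The closed rectangle with real parts in \<open>[a, b]\<close> and imaginary parts in \<open>[c, d]\<close>.\<close>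

definition rect :: "real \<Rightarrow> real \<Rightarrow> real \<Rightarrow> real \<Rightarrow> complex set" where
  "rect a b c d = {z. a \<le> Re z \<and> Re z \<le> b \<and> c \<le> Im z \<and> Im z \<le> d}"

lemma rect_convex: "convex (rect a b c d)" and rect_closed: "closed (rect a b c d)"
proof -
  have e: "rect a b c d = {z. Re z \<ge> a} \<inter> {z. Re z \<le> b} \<inter> {z. Im z \<ge> c} \<inter> {z. Im z \<le> d}"
    by (auto simp: rect_def)
  show "convex (rect a b c d)" unfolding e
    by (intro convex_Int convex_halfspace_Re_ge convex_halfspace_Re_le convex_halfspace_Im_ge convex_halfspace_Im_le)
  show "closed (rect a b c d)" unfolding e
    by (intro closed_Int closed_halfspace_Re_ge closed_halfspace_Re_le closed_halfspace_Im_ge closed_halfspace_Im_le)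
qed

text \<open>Bisection in both directions: narrow rectangles around a vertical segment are good by bisecting
  the vertical interval, and then all rectangles are good by bisecting the horizontal one.\<close>

lemma good_rect:
  assumes "a \<le> b" "c \<le> d"
  shows "good (rect a b c d)"
proof -
  have strip: "\<exists>e>0. \<forall>a b. a \<le> x \<and> x \<le> b \<and> b - a < e \<longrightarrow> good (rect a b c d)" for x
    using \<open>c \<le> d\<close>
  proof (induction c d rule: Bolzano)
    case (trans c m d)
    then obtain e1 e2 where e: "e1 > 0" "e2 > 0"
      "\<And>a b. a \<le> x \<and> x \<le> b \<and> b - a < e1 \<Longrightarrow> good (rect a b c m)"
      "\<And>a b. a \<le> x \<and> x \<le> b \<and> b - a < e2 \<Longrightarrow> good (rect a b m d)" by blast
    show ?case
    proof (intro exI[of _ "min e1 e2"] conjI allI impI)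
      fix a b assume ab: "a \<le> x \<and> x \<le> b \<and> b - a < min e1 e2"
      have u: "rect a b c d = rect a b c m \<union> rect a b m d" using trans by (auto simp: rect_def)
      have "Complex x m \<in> rect a b c m \<inter> rect a b m d" using trans ab by (auto simp: rect_def)
      then show "good (rect a b c d)"
        using ab e rect_convex[of a b c d] unfolding u
        by (intro good_union rect_convex rect_closed) auto
    qed (use e in auto)
  next
    case (local y)
    let ?p = "Complex x y"
    define e where "e = r ?p / 2"
    have e: "e > 0" using r_pos[of ?p] by (simp add: e_def)
    show ?case
    proof (intro exI[of _ e] conjI allI impI e)
      fix c d a b assume h: "c \<le> y \<and> y \<le> d \<and> d - c < e" "a \<le> x \<and> x \<le> b \<and> b - a < e"
      show "good (rect a b c d)"
      proof (rule good_small[of _ ?p])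
        fix z assume "z \<in> rect a b c d"
        then have "\<bar>Re (?p - z)\<bar> < e" "\<bar>Im (?p - z)\<bar> < e" using h by (auto simp: rect_def)
        then have "norm (?p - z) < 2 * e" using cmod_le[of "?p - z"] by linarith
        then show "dist ?p z < r ?p" by (simp add: dist_norm e_def)
      qed
    qed
  qed
  show ?thesis using \<open>a \<le> b\<close>
  proof (induction a b rule: Bolzano)
    case (trans a m b)
    have u: "rect a b c d = rect a m c d \<union> rect m b c d" using trans by (auto simp: rect_def)
    have "Complex m c \<in> rect a m c d \<inter> rect m b c d" using trans \<open>c \<le> d\<close> by (auto simp: rect_def)
    then show ?case
      using trans rect_convex[of a b c d] unfolding u
      by (intro good_union rect_convex rect_closed) auto
  next
    case (local x)
    then show ?case using strip[of x] by blast
  qed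
qed

text \<open>The simple connectedness of the plane in the form needed here. Sections on growing squares around
  \<open>x0\<close> with the same germ at \<open>x0\<close> agree by uniqueness.\<close>

theorem global_section:
  obtains F where "sec UNIV F" "F x0 = s0"
proof -
  define Q where "Q n = rect (Re x0 - real n) (Re x0 + real n) (Im x0 - real n) (Im x0 + real n)" for n
  have x0: "x0 \<in> Q n" for n by (auto simp: Q_def rect_def)
  have mono: "Q m \<subseteq> Q n" if "m \<le> n" for m n using that by (auto simp: Q_def rect_def)
  have "\<exists>F. sec (Q n) F \<and> F x0 = s0" for n
    using good_rect x0[of n] unfolding good_def Q_def by auto
  then obtain F where F: "\<And>n. sec (Q n) (F n)" "\<And>n. F n x0 = s0" by metis
  have agree: "F m x = F n x" if "m \<le> n" "x \<in> Q m" for m n x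
  proof (rule sec_unique[OF _ F(1) sec_subset[OF F(1) mono[OF that(1)]] x0 that(2)])
    show "connected (Q m)" unfolding Q_def by (rule convex_connected[OF rect_convex])
  qed (simp add: F(2))
  define N where "N x = nat \<lceil>norm (x - x0)\<rceil>" for x
  have N: "x \<in> Q n" if "N x \<le> n" for x n
  proof -
    have "norm (x - x0) \<le> real n" using that by (simp add: N_def)
    then show ?thesis using abs_Re_le_cmod[of "x - x0"] abs_Im_le_cmod[of "x - x0"] by (auto simp: Q_def rect_def)
  qed
  have val: "F (N x) x = F n x" if "N x \<le> n" for x n by (rule agree[OF that N]) simp
  have "sec UNIV (\<lambda>x. F (N x) x)"
    unfolding section_on_def
  proof (intro ballI impI)
    fix p x assume d: "dist p x < r p"
    let ?n = "max (N p) (N x)"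
    have "F ?n x = res p x (F ?n p)" by (rule secD[OF F(1) N N d]) simp_all
    then show "F (N x) x = res p x (F (N p) p)" using val[of p ?n] val[of x ?n] by simp
  qed
  then show thesis using that F(2) by blast
qed

end

section \<open>Rhombic tilings and flat transports\<close>

lemma isometry_image_ball:
  fixes f :: "complex \<Rightarrow> complex"
  assumes "\<And>x y. dist (f x) (f y) = dist x y"
  shows "f ` ball m r = ball (f m) r"
proof -
  let ?g = "\<lambda>x. f x - f 0"
  have "orthogonal_transformation ?g"
    unfolding orthogonal_transformation_isometry using assms by (simp add: dist_norm)
  then have "?g ` ball m r = ball (?g m) r" by (rule image_orthogonal_transformation_ball)
  then have "(+) (f 0) ` ?g ` ball m r = (+) (f 0) ` ball (?g m) r" by simp
  then show ?thesis by (simp add: image_image ball_translation[symmetric])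
qed

locale rhombic_tiling =
  fixes \<Lambda> :: "complex set set"
  assumes lattice: "rhombic_lattice \<Lambda>"
begin

lemma tile_rhombus: "T \<in> \<Lambda> \<Longrightarrow> unit_rhombus T"
  using lattice by (simp add: rhombic_lattice_def)

lemma tile_para:
  assumes "T \<in> \<Lambda>" obtains p u v where "T = para p u v" "unit_frame u v"
  using unit_rhombus_para[OF tile_rhombus[OF assms]] .

lemma tile_convex: "T \<in> \<Lambda> \<Longrightarrow> convex T"
  by (erule tile_para) (simp add: para_def)

lemma tile_compact: "T \<in> \<Lambda> \<Longrightarrow> compact T"
  by (erule tile_para) (simp add: para_def finite_imp_compact_convex_hull)

lemma tile_cover: obtains T where "T \<in> \<Lambda>" "x \<in> T"
proof -
  have "x \<in> \<Union>\<Lambda>" using lattice by (simp add: rhombic_lattice_def)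
  then show thesis using that by blast
qed

lemma tile_Int_face: "T \<in> \<Lambda> \<Longrightarrow> T' \<in> \<Lambda> \<Longrightarrow> (T \<inter> T') face_of T"
  using lattice tile_convex[of T] by (cases "T = T'") (simp_all add: rhombic_lattice_def face_of_refl)

lemma tile_interior: "T \<in> \<Lambda> \<Longrightarrow> interior T \<noteq> {}"
  by (erule tile_para) (use para_midpoint_interior in \<open>auto simp: unit_frame_def\<close>)

text \<open>Distinct tiles have disjoint interiors, so neither contains the other.\<close>

lemma tile_Int_proper:
  assumes "T \<in> \<Lambda>" "T' \<in> \<Lambda>" "T \<noteq> T'"
  shows "T \<inter> T' \<noteq> T"
proof
  assume "T \<inter> T' = T"
  then have "interior T \<subseteq> interior T \<inter> interior T'" using interior_mono[of T T'] by auto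
  moreover have "interior T \<inter> interior T' = {}"
    using lattice assms by (simp add: rhombic_lattice_def)
  ultimately show False using tile_interior[OF assms(1)] by simp
qed

text \<open>Congruence enters the argument only here: all tiles contain discs of one common radius.\<close>

lemma inscribed_balls:
  obtains \<rho> c where "\<rho> > 0" "\<And>T. T \<in> \<Lambda> \<Longrightarrow> ball (c T) \<rho> \<subseteq> T"
proof -
  obtain T0 where T0: "T0 \<in> \<Lambda>" using tile_cover by metis
  obtain m \<rho> where m: "\<rho> > 0" "ball m \<rho> \<subseteq> T0"
    using tile_interior[OF T0] by (meson all_not_in_conv mem_interior)
  have "\<exists>c. ball c \<rho> \<subseteq> T" if "T \<in> \<Lambda>" for T
  proof -
    have "congruent_sets T0 T" using lattice that T0 by (simp add: rhombic_lattice_def)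
    then obtain f where f: "\<And>x y. dist (f x) (f y) = dist x y" "f ` T0 = T"
      unfolding congruent_sets_def by blast
    have "f ` ball m \<rho> \<subseteq> T" using m(2) f(2) by blast
    then show ?thesis using isometry_image_ball[of f] f(1) by metis
  qed
  then show thesis using that m(1) by metis
qed

text \<open>The centres of the inscribed discs are uniformly separated, so only finitely many of them lie in a
  bounded set.\<close>

lemma locally_finite: "finite {T \<in> \<Lambda>. T \<inter> ball p 1 \<noteq> {}}" (is "finite ?N")
proof -
  obtain \<rho> c where \<rho>: "\<rho> > 0" and c: "\<And>T. T \<in> \<Lambda> \<Longrightarrow> ball (c T) \<rho> \<subseteq> T"
    using inscribed_balls by blast
  have cT: "c T \<in> T" if "T \<in> \<Lambda>" for T using c[OF that] \<rho> by auto
  have far: "\<rho> \<le> dist (c T) (c T')" if "T \<in> \<Lambda>" "T' \<in> \<Lambda>" "T \<noteq> T'" for T T'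
  proof (rule ccontr)
    assume "\<not> \<rho> \<le> dist (c T) (c T')"
    then have "c T' \<in> ball (c T) \<rho>" "c T' \<in> ball (c T') \<rho>" using \<rho> by auto
    then have "c T' \<in> interior T" "c T' \<in> interior T'"
      using interior_maximal[OF c[OF that(1)] open_ball] interior_maximal[OF c[OF that(2)] open_ball] by blast+
    moreover have "interior T \<inter> interior T' = {}"
      using lattice that by (simp add: rhombic_lattice_def)
    ultimately show False by blast
  qed
  have "uniform_discrete (c ` ?N)"
    using \<rho> far by (intro uniformI2[of \<rho>]) auto
  moreover have "bounded (c ` ?N)"
  proof (rule bounded_subset[OF bounded_cball])
    show "c ` ?N \<subseteq> cball p 3"
    proof clarsimp
      fix T assume T: "T \<in> \<Lambda>" "T \<inter> ball p 1 \<noteq> {}"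
      then obtain x where x: "x \<in> T" "dist p x < 1" by auto
      have "dist x (c T) \<le> 2"
        using T(1) x(1) cT[OF T(1)] by (metis tile_para para_diameter)
      then show "dist p (c T) \<le> 3" using x(2) dist_triangle[of p "c T" x] by simp
    qed
  qed
  ultimately have "finite (c ` ?N)" using uniform_discrete_finite_iff by blast
  moreover have "inj_on c ?N" using far \<rho> by (force intro!: inj_onI)
  ultimately show ?thesis by (rule finite_imageD)
qed

text \<open>Near \<open>p\<close> there are only tiles that contain \<open>p\<close>. The intersection of these is a face of each
  of them, and an extreme point of it is a corner of them all.\<close>

lemma star_exists:
  "\<exists>w r. r > 0 \<and> (\<forall>T\<in>\<Lambda>. T \<inter> ball p r \<noteq> {} \<longrightarrow> p \<in> T \<and> w extreme_point_of T)"
proof -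
  let ?N = "{T \<in> \<Lambda>. T \<inter> ball p 1 \<noteq> {}}"
  let ?C = "\<Union>{T \<in> ?N. p \<notin> T}"
  have cl: "closed ?C"
    by (rule closed_Union)
      (use tile_compact in \<open>auto intro: compact_imp_closed finite_subset[OF _ locally_finite[of p]]\<close>)
  have "p \<in> - ?C" by auto
  from openE[OF open_Compl[OF cl] this] obtain e where e: "e > 0" "ball p e \<subseteq> - ?C" .
  let ?r = "min e 1"
  have near: "p \<in> T" if T: "T \<in> \<Lambda>" "T \<inter> ball p ?r \<noteq> {}" for T
  proof (rule ccontr)
    assume "p \<notin> T"
    obtain x where "x \<in> T" "dist p x < e" "dist p x < 1" using T(2) by auto
    moreover from this have "T \<inter> ball p 1 \<noteq> {}" by auto
    ultimately have "x \<in> ?C" "x \<in> ball p e" using T(1) \<open>p \<notin> T\<close> by auto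
    then show False using e(2) by blast
  qed
  let ?P = "{T \<in> \<Lambda>. p \<in> T}"
  let ?I = "\<Inter>?P"
  obtain T0 where T0: "T0 \<in> \<Lambda>" "p \<in> T0" using tile_cover by metis
  have face: "?I face_of T" if "T \<in> \<Lambda>" "p \<in> T" for T
  proof -
    have "?I = \<Inter>((\<lambda>T'. T \<inter> T') ` ?P)" using that by auto
    also have "\<dots> face_of T" using that by (intro face_of_Inter) (auto intro: tile_Int_face)
    finally show ?thesis .
  qed
  have "compact ?I"
    using face_of_imp_compact[OF tile_convex[OF T0(1)] tile_compact[OF T0(1)] face[OF T0]] .
  moreover have "convex ?I" using face[OF T0] by (rule face_of_imp_convex)
  moreover have "?I \<noteq> {}" by auto
  ultimately obtain w where "w extreme_point_of ?I" by (rule extreme_point_exists_convex)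
  then have "w extreme_point_of T" if "T \<in> \<Lambda>" "p \<in> T" for T
    using extreme_point_of_face[OF face[OF that]] by blast
  with near e(1) show ?thesis
    by (intro exI[of _ w] exI[of _ ?r]) (auto simp: subset_iff)
qed

text \<open>A common corner of all tiles that contain \<open>p\<close>. The choice is arbitrary.\<close>

definition hub :: "complex \<Rightarrow> complex" where
  "hub p = (SOME w. \<exists>r>0. \<forall>T\<in>\<Lambda>. T \<inter> ball p r \<noteq> {} \<longrightarrow> p \<in> T \<and> w extreme_point_of T)"

text \<open>A radius such that all tiles meeting the disc of this radius around \<open>p\<close> contain \<open>p\<close>.\<close>

definition rad :: "complex \<Rightarrow> real" where
  "rad p = (SOME r. r > 0 \<and> (\<forall>T\<in>\<Lambda>. T \<inter> ball p r \<noteq> {} \<longrightarrow> p \<in> T \<and> hub p extreme_point_of T))"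

lemma rad_pos: "rad p > 0"
  and star: "\<And>T x. T \<in> \<Lambda> \<Longrightarrow> x \<in> T \<Longrightarrow> dist p x < rad p \<Longrightarrow> p \<in> T"
  and hub: "\<And>T. T \<in> \<Lambda> \<Longrightarrow> p \<in> T \<Longrightarrow> hub p extreme_point_of T"
proof -
  have "\<exists>r>0. \<forall>T\<in>\<Lambda>. T \<inter> ball p r \<noteq> {} \<longrightarrow> p \<in> T \<and> hub p extreme_point_of T"
    unfolding hub_def by (rule someI_ex) (use star_exists in blast)
  then have *: "rad p > 0 \<and> (\<forall>T\<in>\<Lambda>. T \<inter> ball p (rad p) \<noteq> {} \<longrightarrow> p \<in> T \<and> hub p extreme_point_of T)"
    unfolding rad_def by (rule someI_ex)
  then show "rad p > 0" by simp
  show "p \<in> T" if "T \<in> \<Lambda>" "x \<in> T" "dist p x < rad p" for T x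
    using * that by (auto simp: disjoint_iff)
  show "hub p extreme_point_of T" if "T \<in> \<Lambda>" "p \<in> T" for T
  proof -
    have "p \<in> T \<inter> ball p (rad p)" using * that by simp
    then show ?thesis using * that by blast
  qed
qed

lemma edgesI: "T \<in> \<Lambda> \<Longrightarrow> closed_segment a b edge_of T \<Longrightarrow> (a, b) \<in> edges \<Lambda>"
  by (auto simp: edges_def)

lemma edges_sym: "(a, b) \<in> edges \<Lambda> \<Longrightarrow> (b, a) \<in> edges \<Lambda>"
  by (simp add: edges_def closed_segment_commute)

lemma edges_verts: "(a, b) \<in> edges \<Lambda> \<Longrightarrow> a \<in> verts \<Lambda>" "(a, b) \<in> edges \<Lambda> \<Longrightarrow> b \<in> verts \<Lambda>"
  using edge_endpoints_extreme(1,2) unfolding edges_def verts_def by blast+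

lemma edge_tile:
  assumes "(a, b) \<in> edges \<Lambda>"
  obtains v where "para a (b - a) v \<in> \<Lambda>" "unit_frame (b - a) v"
  using assms edge_of_rhombus tile_rhombus unfolding edges_def by blast

lemma norm_edge: "(a, b) \<in> edges \<Lambda> \<Longrightarrow> norm (b - a) = 1"
  by (erule edge_tile) (simp add: unit_frame_def)

lemma para_edges:
  assumes "para p u v \<in> \<Lambda>" "unit_frame u v"
  shows "(p, p + u) \<in> edges \<Lambda>" "(p, p + v) \<in> edges \<Lambda>"
    "(p + u, p + u + v) \<in> edges \<Lambda>" "(p + v, p + u + v) \<in> edges \<Lambda>"
  using edgesI[OF assms(1)] edge_of_para[OF assms(2)] by simp_all

text \<open>Distinct tiles cannot share a diagonal, since their intersection is a proper face.\<close>

lemma shared_corners_edge: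
  assumes "T \<in> \<Lambda>" "T' \<in> \<Lambda>" "T \<noteq> T'" "a \<noteq> b"
    and "a extreme_point_of T" "b extreme_point_of T" "a \<in> T'" "b \<in> T'"
  shows "closed_segment a b edge_of T"
proof -
  obtain u v where T: "T = para a u v" and f: "unit_frame u v"
    using rebase_para[OF tile_rhombus[OF assms(1)] assms(5)] .
  have D: "Im (cnj u * v) \<noteq> 0" using f by (simp add: unit_frame_def)
  have ab: "a \<in> T \<inter> T'" "b \<in> T \<inter> T'"
    using assms by (auto simp: extreme_point_of_def)
  have "b \<noteq> a + u + v"
  proof
    assume "b = a + u + v"
    then have "T \<inter> T' = T"
      using face_with_opposite_corners[OF D, of "T \<inter> T'" a] tile_Int_face[OF assms(1,2)] ab T by simp
    then show False using tile_Int_proper assms by blast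
  qed
  then have "b = a + u \<or> b = a + v"
    using extreme_point_of_para[OF f] assms(4,6) T by auto
  then show ?thesis using edge_of_para[OF f] T by auto
qed

lemma corners_connected:
  assumes "T \<in> \<Lambda>" "a extreme_point_of T" "b extreme_point_of T"
  shows "(a, b) \<in> (edges \<Lambda>)\<^sup>*"
proof -
  obtain u v where T: "T = para a u v" and f: "unit_frame u v"
    using rebase_para[OF tile_rhombus[OF assms(1)] assms(2)] .
  note e = para_edges[of a u v, OF _ f] 
  have "b \<in> {a, a + u, a + u + v, a + v}" using extreme_point_of_para[OF f] assms(3) T by simp
  then show ?thesis using e assms(1) T
    by (auto intro: rtrancl_into_rtrancl)
qed

text \<open>The hubs of neighbouring points are corners of one tile, hence connected in its boundary; since the
  plane is connected, all hubs are connected.\<close>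

lemma verts_connected:
  assumes "a \<in> verts \<Lambda>" "b \<in> verts \<Lambda>"
  shows "(a, b) \<in> (edges \<Lambda>)\<^sup>*"
proof -
  have sym: "(y, x) \<in> (edges \<Lambda>)\<^sup>*" if "(x, y) \<in> (edges \<Lambda>)\<^sup>*" for x y
    using that edges_sym by (meson symD symI sym_rtrancl)
  have "(hub a, hub b) \<in> (edges \<Lambda>)\<^sup>*"
  proof (rule connected_equivalence_relation[of UNIV a b "\<lambda>x y. (hub x, hub y) \<in> (edges \<Lambda>)\<^sup>*"])
    fix p :: complex
    have "(hub p, hub x) \<in> (edges \<Lambda>)\<^sup>*" if "x \<in> ball p (rad p)" for x
    proof -
      obtain T where T: "T \<in> \<Lambda>" "x \<in> T" using tile_cover by metis
      then have "p \<in> T" using star that by simp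
      then show ?thesis using corners_connected hub T by blast
    qed
    then show "\<exists>T. openin (top_of_set UNIV) T \<and> p \<in> T \<and> (\<forall>x\<in>T. (hub p, hub x) \<in> (edges \<Lambda>)\<^sup>*)"
      using rad_pos by (intro exI[of _ "ball p (rad p)"]) auto
  qed (auto intro: sym)
  moreover have "(c, hub c) \<in> (edges \<Lambda>)\<^sup>*" if "c \<in> verts \<Lambda>" for c
  proof -
    obtain T where "T \<in> \<Lambda>" "c extreme_point_of T" using \<open>c \<in> verts \<Lambda>\<close> by (auto simp: verts_def)
    then show ?thesis using corners_connected hub extreme_point_of_def by metis
  qed
  ultimately show ?thesis using assms sym by (meson rtrancl_trans)
qed

end

text \<open>A transport of values of type \<open>'g\<close> along the edges that is trivial around every tile. The maps
  need not come from a commutative group.\<close>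

locale transport = rhombic_tiling +
  fixes \<tau> :: "complex \<Rightarrow> complex \<Rightarrow> 'g \<Rightarrow> 'g"
  assumes transport_inverse: "(a, b) \<in> edges \<Lambda> \<Longrightarrow> \<tau> b a (\<tau> a b s) = s"
    and transport_tile: "para p u v \<in> \<Lambda> \<Longrightarrow> unit_frame u v \<Longrightarrow>
      \<tau> (p + u) (p + u + v) (\<tau> p (p + u) s) = \<tau> (p + v) (p + u + v) (\<tau> p (p + v) s)"
begin

text \<open>A function that is compatible with the transport along the sides of \<open>T\<close>.\<close>

definition flat_on :: "complex set \<Rightarrow> (complex \<Rightarrow> 'g) \<Rightarrow> bool" where
  "flat_on T F \<longleftrightarrow> (\<forall>a b. closed_segment a b edge_of T \<longrightarrow> F b = \<tau> a b (F a))"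

lemma flat_exists:
  assumes "T \<in> \<Lambda>" "a extreme_point_of T"
  obtains F where "flat_on T F" "F a = s"
proof -
  obtain u v where T: "T = para a u v" and f: "unit_frame u v"
    using rebase_para[OF tile_rhombus[OF assms(1)] assms(2)] .
  have D: "Im (cnj u * v) \<noteq> 0" using f by (simp add: unit_frame_def)
  then have ne: "u \<noteq> 0" "v \<noteq> 0" "u \<noteq> v" "v \<noteq> u" by auto
  have ne2: "u + v \<noteq> 0"
  proof
    assume "u + v = 0" then have "v = - u" by (simp add: add_eq_0_iff)
    then show False using D by simp
  qed
  note e = para_edges[OF assms(1)[unfolded T] f]
  note t = transport_tile[OF assms(1)[unfolded T] f]
  define F where "F x = (if x = a then s else if x = a + u then \<tau> a (a+u) s
     else if x = a + v then \<tau> a (a+v) s else \<tau> (a+u) (a+u+v) (\<tau> a (a+u) s))" for x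
  have val: "F a = s" "F (a+u) = \<tau> a (a+u) s" "F (a+v) = \<tau> a (a+v) s"
    "F (a+u+v) = \<tau> (a+u) (a+u+v) (\<tau> a (a+u) s)"
    using ne ne2 by (auto simp: F_def add.assoc)
  have "F d = \<tau> c d (F c)" if "closed_segment c d edge_of T" for c d
    using that unfolding T edge_of_para[OF f]
    using val t[of s] transport_inverse[OF e(1)] transport_inverse[OF e(2)]
      transport_inverse[OF e(3)] transport_inverse[OF e(4)] by (smt (verit) insert_iff empty_iff prod.inject)
  then show thesis using that[of F] val(1) by (simp add: flat_on_def)
qed

lemma flat_unique:
  assumes "T \<in> \<Lambda>" "flat_on T F" "flat_on T G"
    and "a extreme_point_of T" "b extreme_point_of T" "F a = G a"
  shows "F b = G b"
proof -
  obtain u v where T: "T = para a u v" and f: "unit_frame u v"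
    using rebase_para[OF tile_rhombus[OF assms(1)] assms(4)] .
  have e: "closed_segment a (a+u) edge_of T" "closed_segment a (a+v) edge_of T"
    "closed_segment (a+u) (a+u+v) edge_of T" using edge_of_para[OF f] T by simp_all
  have "F (a+u) = G (a+u)" "F (a+v) = G (a+v)"
    using e(1,2) assms(2,3,6) by (auto simp: flat_on_def)
  moreover have "F (a+u+v) = G (a+u+v)"
    using e(3) assms(2,3) calculation(1) unfolding flat_on_def by metis
  moreover have "b \<in> {a, a + u, a + u + v, a + v}" using extreme_point_of_para[OF f] assms(5) T by simp
  ultimately show ?thesis using assms(6) by auto
qed

text \<open>Two corners shared by distinct tiles are equal or adjacent, so that the transport between them
  does not depend on the tile.\<close>

lemma flat_agree:
  assumes "T \<in> \<Lambda>" "T' \<in> \<Lambda>" "flat_on T F" "flat_on T' G"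
    and "a extreme_point_of T" "b extreme_point_of T" "a extreme_point_of T'" "b extreme_point_of T'"
    and "F a = G a"
  shows "F b = G b"
proof (cases "T = T' \<or> a = b")
  case True then show ?thesis using assms flat_unique by blast
next
  case False
  have "a \<in> T" "b \<in> T" "a \<in> T'" "b \<in> T'" using assms(5-8) by (auto simp: extreme_point_of_def)
  then have "closed_segment a b edge_of T" "closed_segment a b edge_of T'"
    using False assms shared_corners_edge by blast+
  then show ?thesis using assms(3,4,9) by (simp add: flat_on_def)
qed

text \<open>The transport between two corners of a common tile, opposite corners included.\<close>

definition carry :: "complex \<Rightarrow> complex \<Rightarrow> 'g \<Rightarrow> 'g" where
  "carry a b s = (SOME s'. \<exists>T\<in>\<Lambda>. \<exists>F. flat_on T F \<and> a extreme_point_of T \<and> b extreme_point_of T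
     \<and> F a = s \<and> F b = s')"

lemma carry_eq:
  assumes "T \<in> \<Lambda>" "flat_on T F" "a extreme_point_of T" "b extreme_point_of T"
  shows "carry a b (F a) = F b"
  unfolding carry_def
proof (rule some_equality)
  show "\<exists>T\<in>\<Lambda>. \<exists>G. flat_on T G \<and> a extreme_point_of T \<and> b extreme_point_of T \<and> G a = F a \<and> G b = F b"
    using assms by blast
  show "s' = F b"
    if s': "\<exists>T\<in>\<Lambda>. \<exists>G. flat_on T G \<and> a extreme_point_of T \<and> b extreme_point_of T \<and> G a = F a \<and> G b = s'" for s'
  proof -
    obtain T' G where "T' \<in> \<Lambda>" "flat_on T' G" "a extreme_point_of T'" "b extreme_point_of T'"
      "G a = F a" "G b = s'" using s' by blast
    then show ?thesis using flat_agree[of T' T G F a b] assms by simp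
  qed
qed

lemma carry_trans:
  assumes "T \<in> \<Lambda>" "a extreme_point_of T" "b extreme_point_of T" "c extreme_point_of T"
  shows "carry b c (carry a b s) = carry a c s"
proof -
  obtain F where F: "flat_on T F" "F a = s" using flat_exists assms by metis
  then show ?thesis using carry_eq[OF assms(1) F(1)] assms by metis
qed

lemma carry_same:
  assumes "T \<in> \<Lambda>" "a extreme_point_of T" shows "carry a a s = s"
proof -
  obtain F where F: "flat_on T F" "F a = s" using flat_exists assms by metis
  then show ?thesis using carry_eq[OF assms(1) F(1)] assms by metis
qed

text \<open>The germ at \<open>p\<close> is the value at the hub of \<open>p\<close>. If \<open>x\<close> is near \<open>p\<close>, any tile that contains
  \<open>x\<close> also contains \<open>p\<close>, and has the hubs of both as corners.\<close>

sublocale germs: germ_system rad "\<lambda>p x. carry (hub p) (hub x)"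
proof
  fix p x y s
  show "rad p > 0" by (rule rad_pos)
  show "bij (carry (hub p) (hub x))" if "dist p x < rad p"
  proof -
    obtain T where T: "T \<in> \<Lambda>" "x \<in> T" using tile_cover by metis
    then have "p \<in> T" using star that by blast
    then have h: "hub p extreme_point_of T" "hub x extreme_point_of T" using hub T by auto
    show ?thesis
      by (rule o_bij[of "carry (hub x) (hub p)"])
        (use carry_trans[OF T(1)] carry_same[OF T(1)] h in \<open>auto simp: fun_eq_iff\<close>)
  qed
  show "carry (hub p) (hub y) s = carry (hub x) (hub y) (carry (hub p) (hub x) s)"
    if "dist p x < rad p" "dist p y < rad p" "dist x y < rad x"
  proof -
    obtain T where T: "T \<in> \<Lambda>" "y \<in> T" using tile_cover by metis
    then have "p \<in> T" "x \<in> T" using star that by blast+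
    then show ?thesis using carry_trans[OF T(1)] hub T by metis
  qed
qed

text \<open>Transport trivial around each tile is trivial along all closed paths, in the form of a
  global compatible function with a prescribed value.\<close>

theorem potential_exists:
  assumes z0: "z0 \<in> verts \<Lambda>"
  obtains F where "F z0 = s0" "\<And>a b. (a, b) \<in> edges \<Lambda> \<Longrightarrow> F b = \<tau> a b (F a)"
proof -
  obtain T0 where T0: "T0 \<in> \<Lambda>" "z0 extreme_point_of T0" using z0 by (auto simp: verts_def)
  have h0: "hub z0 extreme_point_of T0" using T0 hub extreme_point_of_def by metis
  obtain \<phi> where \<phi>: "germs.sec UNIV \<phi>" "\<phi> z0 = carry z0 (hub z0) s0"
    using germs.global_section .
  define F where "F x = carry (hub x) x (\<phi> x)" for x
  have "F z0 = s0"
    unfolding F_def \<phi>(2) using carry_trans[OF T0] carry_same[OF T0] h0 T0 by metis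
  moreover have "F b = \<tau> a b (F a)" if "(a, b) \<in> edges \<Lambda>" for a b
  proof -
    obtain T where T: "T \<in> \<Lambda>" "closed_segment a b edge_of T" using \<open>(a, b) \<in> edges \<Lambda>\<close> by (auto simp: edges_def)
    have ext: "a extreme_point_of T" "b extreme_point_of T" using edge_endpoints_extreme[OF T(2)] by auto
    then have mem: "a \<in> T" "b \<in> T" by (auto simp: extreme_point_of_def)
    obtain G where G: "flat_on T G" "G (hub a) = \<phi> a"
      using flat_exists[OF T(1) hub[OF T(1) mem(1)]] by metis
    \<comment> \<open>the endpoints of an edge need not be close, so the section is compared with a flat function on the whole tile\<close>
    have "germs.sec T (\<lambda>x. G (hub x))"
      unfolding section_on_def using carry_eq[OF T(1) G(1)] hub[OF T(1)] by metis
    moreover have "germs.sec T \<phi>" using \<phi>(1) germs.sec_subset by blast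
    moreover have "connected T" using tile_convex[OF T(1)] by (rule convex_connected)
    ultimately have "G (hub b) = \<phi> b"
      using germs.sec_unique[of T "\<lambda>x. G (hub x)" \<phi> a b] mem G(2) by simp
    then have "F a = G a" "F b = G b"
      unfolding F_def using carry_eq[OF T(1) G(1) hub[OF T(1) mem(1)] ext(1)]
        carry_eq[OF T(1) G(1) hub[OF T(1) mem(2)] ext(2)] G(2) by simp_all
    then show ?thesis using G(1) T(2) by (simp add: flat_on_def)
  qed
  ultimately show thesis by (rule that)
qed

end

section \<open>Discrete analytic functions and the shift operators\<close>

context rhombic_tiling
begin

lemma path_exists:
  assumes "(a, b) \<in> (edges \<Lambda>)\<^sup>*" "a \<in> verts \<Lambda>"
  obtains N z where "is_path \<Lambda> N z a b"
proof -
  have "\<exists>N z. is_path \<Lambda> N z a b"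
    using assms(1)
  proof (induction rule: rtrancl_induct)
    case base
    show ?case using assms(2) by (intro exI[of _ 0] exI[of _ "\<lambda>_. a"]) (simp add: is_path_def)
  next
    case (step b c)
    then obtain N z where z: "is_path \<Lambda> N z a b" by blast
    have "is_path \<Lambda> (Suc N) (z(Suc N := c)) a c"
      using z step(2) edges_verts[OF step(2)]
      by (auto simp: is_path_def le_Suc_eq)
    then show ?case by blast
  qed
  then show thesis using that by blast
qed

lemma path_integral_primitive:
  assumes \<Phi>: "\<And>x y. (x, y) \<in> edges \<Lambda> \<Longrightarrow> (f x + f y) / 2 * (y - x) = \<Phi> y - \<Phi> x"
    and z: "is_path \<Lambda> N z a b"
  shows "path_integral N z f = \<Phi> b - \<Phi> a"
proof -
  have "path_integral N z f = (\<Sum>n=Suc 0..N. \<Phi> (z n) - \<Phi> (z (n - 1)))"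
    unfolding path_integral_def
  proof (rule sum.cong)
    fix n assume "n \<in> {Suc 0..N}"
    then have "(z (n - 1), z n) \<in> edges \<Lambda>" using z by (simp add: is_path_def)
    then show "(f (z (n - 1)) + f (z n)) / 2 * (z n - z (n - 1)) = \<Phi> (z n) - \<Phi> (z (n - 1))"
      by (rule \<Phi>)
  qed simp
  also have "\<dots> = \<Phi> (z N) - \<Phi> (z 0)" by (rule sum_telescope'') simp
  finally show ?thesis using z by (simp add: is_path_def)
qed

lemma DA_integral_primitive:
  assumes \<Phi>: "\<And>x y. (x, y) \<in> edges \<Lambda> \<Longrightarrow> (f x + f y) / 2 * (y - x) = \<Phi> y - \<Phi> x"
    and "a \<in> verts \<Lambda>" "b \<in> verts \<Lambda>"
  shows "DA_integral \<Lambda> a b f = \<Phi> b - \<Phi> a"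
  unfolding DA_integral_def
proof (rule the_equality)
  obtain N z where "is_path \<Lambda> N z a b" using path_exists verts_connected assms(2,3) by metis
  then show "\<exists>N z. is_path \<Lambda> N z a b \<and> \<Phi> b - \<Phi> a = path_integral N z f"
    using path_integral_primitive[of f \<Phi>, OF \<Phi>] by metis
  show "w = \<Phi> b - \<Phi> a" if "\<exists>N z. is_path \<Lambda> N z a b \<and> w = path_integral N z f" for w
    using that path_integral_primitive[of f \<Phi>, OF \<Phi>] by metis
qed

lemma DA_if_primitive:
  assumes "\<And>x y. (x, y) \<in> edges \<Lambda> \<Longrightarrow> (f x + f y) / 2 * (y - x) = \<Phi> y - \<Phi> x"
    and "\<And>z. z \<notin> verts \<Lambda> \<Longrightarrow> f z = 0"
  shows "f \<in> DA \<Lambda>"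
  using path_integral_primitive[of f \<Phi>, OF assms(1)] assms(2) by (auto simp: DA_def)

lemma DA_zero: "f \<in> DA \<Lambda> \<Longrightarrow> z \<notin> verts \<Lambda> \<Longrightarrow> f z = 0"
  by (simp add: DA_def)

text \<open>The vanishing of the integral around one tile: the discrete Cauchy-Riemann equation.\<close>

lemma DA_tile:
  assumes f: "f \<in> DA \<Lambda>" and T: "para p u v \<in> \<Lambda>" "unit_frame u v"
  shows "u * (f p + f (p + u) - f (p + v) - f (p + u + v)) = v * (f p + f (p + v) - f (p + u) - f (p + u + v))"
proof -
  let ?z = "\<lambda>n. [p, p + u, p + u + v, p + v, p] ! n"
  note e = para_edges[OF T]
  have "is_path \<Lambda> 4 ?z p p"
    unfolding is_path_def
    using e edges_sym[OF e(4)] edges_sym[OF e(2)] edges_verts(1)[OF e(1)] edges_verts(2)[OF e(1)]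
      edges_verts(2)[OF e(2)] edges_verts(2)[OF e(3)]
    by (auto simp: atLeastAtMost_iff numeral_eq_Suc le_Suc_eq)
  then have "path_integral 4 ?z f = 0" using f unfolding DA_def by blast
  then have "(f p + f (p+u)) / 2 * u + (f (p+u) + f (p+u+v)) / 2 * v
      + (f (p+u+v) + f (p+v)) / 2 * (- u) + (f (p+v) + f p) / 2 * (- v) = 0"
    by (simp add: path_integral_def numeral_eq_Suc)
  then show ?thesis by (simp add: field_simps) algebra
qed

text \<open>The converse of \<open>DA_if_primitive\<close>. Only integrals around tiles are used, instead of the
  independence of the path.\<close>

lemma DA_primitive:
  assumes f: "f \<in> DA \<Lambda>"
  obtains \<Phi> where "\<And>x y. (x, y) \<in> edges \<Lambda> \<Longrightarrow> (f x + f y) / 2 * (y - x) = \<Phi> y - \<Phi> x"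
proof -
  interpret transport \<Lambda> "\<lambda>a b s. s + (f a + f b) / 2 * (b - a)"
  proof
    show "s + (f a + f b) / 2 * (b - a) + (f b + f a) / 2 * (a - b) = s" for a b s
      by (simp add: field_simps)
    fix p u v s assume T: "para p u v \<in> \<Lambda>" "unit_frame u v"
    show "s + (f p + f (p + u)) / 2 * (p + u - p) + (f (p + u) + f (p + u + v)) / 2 * (p + u + v - (p + u))
      = s + (f p + f (p + v)) / 2 * (p + v - p) + (f (p + v) + f (p + u + v)) / 2 * (p + u + v - (p + v))"
      using DA_tile[OF f T] by (simp add: field_simps) algebra
  qed
  obtain T p u v where "T \<in> \<Lambda>" "T = para p u v" "unit_frame u v"
    using tile_cover[of 0] tile_para by metis
  then have "p \<in> verts \<Lambda>" using para_edges(1) edges_verts(1) by blast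
  then obtain \<Phi> :: "complex \<Rightarrow> complex" where
    "\<And>a b. (a, b) \<in> edges \<Lambda> \<Longrightarrow> \<Phi> b = \<Phi> a + (f a + f b) / 2 * (b - a)"
    using potential_exists[of p 0] by metis
  then show thesis using that[of \<Phi>] by simp
qed

text \<open>The equation \<open>Z_plus \<Lambda> g = h - h 0\<close>, differenced along an edge and multiplied by 2.\<close>

definition shift_rel :: "(complex \<Rightarrow> complex) \<Rightarrow> (complex \<Rightarrow> complex) \<Rightarrow> bool" where
  "shift_rel g h \<longleftrightarrow>
     (\<forall>a b. (a, b) \<in> edges \<Lambda> \<longrightarrow> 2 * (h b - h a) = (g a - g b) + (g a + g b) * (b - a))"

lemma shift_relD:
  "shift_rel g h \<Longrightarrow> (a, b) \<in> edges \<Lambda> \<Longrightarrow> 2 * (h b - h a) = (g a - g b) + (g a + g b) * (b - a)"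
  by (simp add: shift_rel_def)

text \<open>If the relation holds, then \<open>h + g / 2\<close> is a primitive of \<open>g\<close>; no
  assumption of analyticity is needed.\<close>

lemma shift_rel_primitive:
  assumes "shift_rel g h" "(a, b) \<in> edges \<Lambda>"
  shows "(g a + g b) / 2 * (b - a) = (h b + g b / 2) - (h a + g a / 2)"
proof -
  have "(g a + g b) * (b - a) = 2 * (h b - h a) - (g a - g b)"
    using shift_relD[OF assms] by simp
  then show ?thesis by (simp only: times_divide_eq_left) (simp add: field_simps)
qed

lemma shift_rel_DA: "shift_rel g h \<Longrightarrow> (\<And>z. z \<notin> verts \<Lambda> \<Longrightarrow> g z = 0) \<Longrightarrow> g \<in> DA \<Lambda>"
  using DA_if_primitive[of g "\<lambda>z. h z + g z / 2"] shift_rel_primitive by blast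

lemma Z_plus_iff_shift_rel:
  assumes g: "g \<in> DA \<Lambda>" and 0: "0 \<in> verts \<Lambda>"
  shows "(\<forall>z\<in>verts \<Lambda>. Z_plus \<Lambda> g z = h z - h 0) \<longleftrightarrow> shift_rel g h"
proof
  assume L: "\<forall>z\<in>verts \<Lambda>. Z_plus \<Lambda> g z = h z - h 0"
  obtain \<Phi> where \<Phi>: "\<And>x y. (x, y) \<in> edges \<Lambda> \<Longrightarrow> (g x + g y) / 2 * (y - x) = \<Phi> y - \<Phi> x"
    using DA_primitive[OF g] by metis
  have *: "(g 0 - g z) / 2 + (\<Phi> z - \<Phi> 0) = h z - h 0" if "z \<in> verts \<Lambda>" for z
  proof -
    have "Z_plus \<Lambda> g z = h z - h 0" using L that by blast
    then show ?thesis
      using that DA_integral_primitive[of g \<Phi>, OF \<Phi> 0 that] by (simp only: Z_plus_def if_True)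
  qed
  show "shift_rel g h"
    unfolding shift_rel_def
  proof (intro allI impI)
    fix a b assume e: "(a, b) \<in> edges \<Lambda>"
    have "h b - h a = (g a - g b) / 2 + (\<Phi> b - \<Phi> a)"
      using *[OF edges_verts(1)[OF e]] *[OF edges_verts(2)[OF e]] by (simp add: field_simps) algebra
    then have "h b - h a = (g a - g b) / 2 + (g a + g b) / 2 * (b - a)"
      by (simp only: \<Phi>[OF e])
    moreover have "(g a - g b) + (g a + g b) * (b - a) = 2 * ((g a - g b) / 2 + (g a + g b) / 2 * (b - a))"
      by (simp add: field_simps)
    ultimately show "2 * (h b - h a) = (g a - g b) + (g a + g b) * (b - a)" by simp
  qed
next
  assume R: "shift_rel g h"
  show "\<forall>z\<in>verts \<Lambda>. Z_plus \<Lambda> g z = h z - h 0"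
  proof
    fix z assume z: "z \<in> verts \<Lambda>"
    have "DA_integral \<Lambda> 0 z g = (h z + g z / 2) - (h 0 + g 0 / 2)"
      by (rule DA_integral_primitive[OF shift_rel_primitive[OF R] 0 z])
    then have "Z_plus \<Lambda> g z = (g 0 - g z) / 2 + ((h z + g z / 2) - (h 0 + g 0 / 2))"
      using z by (simp only: Z_plus_def if_True)
    then show "Z_plus \<Lambda> g z = h z - h 0" by (simp add: diff_divide_distrib)
  qed
qed

text \<open>Edges other than the two horizontal unit steps.\<close>

definition slanted :: "(complex \<times> complex) set" where
  "slanted = {(a, b) \<in> edges \<Lambda>. b - a \<noteq> 1 \<and> b - a \<noteq> -1}"

lemma slanted_sym: "(a, b) \<in> slanted\<^sup>* \<Longrightarrow> (b, a) \<in> slanted\<^sup>*"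
proof -
  have "(y, x) \<in> slanted" if "(x, y) \<in> slanted" for x y
    using that edges_sym unfolding slanted_def by clarsimp (metis minus_diff_eq minus_minus)
  then show "(a, b) \<in> slanted\<^sup>* \<Longrightarrow> (b, a) \<in> slanted\<^sup>*"
    by (meson symD symI sym_rtrancl)
qed

end

text \<open>From every vertex, slanted steps lead to a vertex from which an edge of direction 1 leaves.\<close>

locale escaping_tiling = rhombic_tiling +
  assumes escape: "\<forall>w\<in>verts \<Lambda>. \<exists>N z b. N \<ge> 1 \<and> is_path \<Lambda> N z w b \<and>
          (\<forall>n\<in>{1..N - 1}. z n - z (n - 1) \<noteq> 1 \<and> z n - z (n - 1) \<noteq> -1) \<and>
          z N - z (N - 1) = 1"
begin

lemma escape_step:
  assumes "w \<in> verts \<Lambda>"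
  obtains a where "(w, a) \<in> slanted\<^sup>*" "(a, a + 1) \<in> edges \<Lambda>"
proof -
  obtain N z b where N: "N \<ge> 1" and z: "is_path \<Lambda> N z w b"
    and s: "\<forall>n\<in>{1..N - 1}. z n - z (n - 1) \<noteq> 1 \<and> z n - z (n - 1) \<noteq> -1"
    and l: "z N - z (N - 1) = 1" using escape assms by blast
  have "(w, z n) \<in> slanted\<^sup>*" if "n \<le> N - 1" for n
    using that
  proof (induction n)
    case 0 then show ?case using z by (simp add: is_path_def)
  next
    case (Suc n)
    then have "(z n, z (Suc n)) \<in> slanted"
      using z s[rule_format, of "Suc n"] by (auto simp: is_path_def slanted_def dest: bspec[of _ _ "Suc n"])
    then show ?case using Suc by (meson Suc_leD rtrancl.rtrancl_into_rtrancl)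
  qed
  then have "(w, z (N - 1)) \<in> slanted\<^sup>*" by blast
  moreover have "(z (N - 1), z (N - 1) + 1) \<in> edges \<Lambda>"
  proof -
    have "(z (N - 1), z N) \<in> edges \<Lambda>" using z N by (auto simp: is_path_def)
    moreover have "z N = z (N - 1) + 1" using l by (simp add: algebra_simps)
    ultimately show ?thesis by simp
  qed
  ultimately show thesis by (rule that)
qed

text \<open>Along a slanted step the shift relation determines either value of \<open>g\<close> from the other, as
  the coefficient \<open>y - x - 1\<close> of \<open>g y\<close> is nonzero. The relation is assumed only along the
  steps reachable from \<open>a\<close>, so that the lemma also applies to functions that solve it on part of
  the graph.\<close>

lemma slanted_propagates:
  assumes "(a, b) \<in> slanted\<^sup>*" "g a = g' a"
    and g: "\<And>x y. (x, y) \<in> slanted \<Longrightarrow> (a, x) \<in> slanted\<^sup>* \<Longrightarrow> 2 * (h y - h x) = (g x - g y) + (g x + g y) * (y - x)"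
    and g': "\<And>x y. (x, y) \<in> slanted \<Longrightarrow> (a, x) \<in> slanted\<^sup>* \<Longrightarrow> 2 * (h y - h x) = (g' x - g' y) + (g' x + g' y) * (y - x)"
  shows "g b = g' b"
  using assms(1)
proof (induction rule: rtrancl_induct)
  case base then show ?case using assms(2) by simp
next
  case (step b c)
  have "c - b - 1 \<noteq> 0" using step(2) by (auto simp: slanted_def)
  moreover have "g c * (c - b - 1) = 2 * (h c - h b) - g b * (1 + c - b)"
    using g[OF step(2,1)] by (simp add: algebra_simps)
  moreover have "g' c * (c - b - 1) = 2 * (h c - h b) - g' b * (1 + c - b)"
    using g'[OF step(2,1)] by (simp add: algebra_simps)
  moreover note step(3)
  ultimately show ?case by (metis mult_right_cancel)
qed

text \<open>Along a step of direction 1, the relation between \<open>g\<close> and \<open>h\<close> involves \<open>g\<close> only at the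
  starting point and determines it there.\<close>

lemma shift_rel_unique:
  assumes "shift_rel g h" "shift_rel g' h" "w \<in> verts \<Lambda>"
  shows "g w = g' w"
proof -
  obtain a where a: "(w, a) \<in> slanted\<^sup>*" "(a, a + 1) \<in> edges \<Lambda>" using escape_step assms(3) .
  have "g a = g' a"
    using shift_relD[OF assms(1) a(2)] shift_relD[OF assms(2) a(2)] by simp
  then show ?thesis
    using slanted_sym[OF a(1)] shift_relD[OF assms(1)] shift_relD[OF assms(2)]
    by (intro slanted_propagates[of a w g g' h]) (auto simp: slanted_def)
qed

lemma Z_minus_eq:
  assumes R: "shift_rel g h" and off: "\<And>z. z \<notin> verts \<Lambda> \<Longrightarrow> g z = 0" and 0: "0 \<in> verts \<Lambda>"
  shows "Z_minus \<Lambda> h = g"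
  unfolding Z_minus_def
proof (rule the_equality)
  have g: "g \<in> DA \<Lambda>" using shift_rel_DA R off by blast
  then show "g \<in> DA \<Lambda> \<and> (\<forall>z\<in>verts \<Lambda>. Z_plus \<Lambda> g z = h z - h 0)"
    using Z_plus_iff_shift_rel[OF _ 0] R by blast
  fix g' assume g': "g' \<in> DA \<Lambda> \<and> (\<forall>z\<in>verts \<Lambda>. Z_plus \<Lambda> g' z = h z - h 0)"
  then have "shift_rel g' h" using Z_plus_iff_shift_rel[OF _ 0] by blast
  then have "g' w = g w" if "w \<in> verts \<Lambda>" for w using shift_rel_unique R that by blast
  then show "g' = g" using g' off DA_zero by (metis ext)
qed

end

section \<open>Levels and tracks\<close>

context rhombic_tiling
begin

text \<open>A tile that contains the midpoint of an edge has this edge as a side.\<close>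

lemma edge_midpoint_tile:
  assumes "(a, b) \<in> edges \<Lambda>" "T \<in> \<Lambda>" "(a + b) / 2 \<in> T"
  shows "closed_segment a b edge_of T"
proof -
  obtain T1 where T1: "T1 \<in> \<Lambda>" "closed_segment a b edge_of T1" using assms(1) by (auto simp: edges_def)
  note ext = edge_endpoints_extreme[OF T1(2)]
  have "closed_segment a b \<subseteq> T1" using T1(2) edge_of_imp_subset by blast
  then have m: "a \<in> T1" "b \<in> T1" "(a + b) / 2 \<in> T1"
    using midpoint_in_closed_segment[of a b] by (auto simp: midpoint_def scaleR_conv_of_real)
  have "(a + b) / 2 \<in> open_segment a b"
    using midpoint_in_open_segment[of a b] ext(3) by (simp add: midpoint_def scaleR_conv_of_real)
  then have I: "a \<in> T1 \<inter> T" "b \<in> T1 \<inter> T"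
    using face_ofD[OF tile_Int_face[OF T1(1) assms(2)], of "(a+b)/2" a b] m assms(3) by auto
  have F: "(T1 \<inter> T) face_of T" using tile_Int_face[OF assms(2) T1(1)] by (simp add: Int_commute)
  have "a extreme_point_of T" "b extreme_point_of T"
    using extreme_point_of_face[OF F] extreme_point_of_face[OF tile_Int_face[OF T1(1) assms(2)]] ext I by blast+
  then show ?thesis
    using shared_corners_edge[OF assms(2) T1(1) _ ext(3)] T1(2) m by (cases "T = T1") auto
qed

text \<open>On either side of a horizontal edge there is a tile that has it as a side.\<close>

lemma tile_on_side:
  assumes e: "(p, p + 1) \<in> edges \<Lambda>" and \<epsilon>: "\<epsilon> = 1 \<or> \<epsilon> = (-1::real)"
  obtains v where "para p 1 v \<in> \<Lambda>" "unit_frame 1 v" "\<epsilon> * Im v > 0"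
proof -
  let ?m = "p + 1 / 2"
  define \<delta> where "\<delta> = rad ?m / 2"
  have \<delta>: "\<delta> > 0" "\<delta> < rad ?m" using rad_pos[of ?m] by (simp_all add: \<delta>_def)
  \<comment> \<open>a point slightly above or below the midpoint of the edge\<close>
  let ?y = "?m + of_real (\<epsilon> * \<delta>) * \<i>"
  obtain T where T: "T \<in> \<Lambda>" "?y \<in> T" using tile_cover by metis
  have "dist ?m ?y = \<delta>" using \<epsilon> \<delta> by (auto simp: dist_norm norm_mult)
  then have "?m \<in> T" using star[OF T] \<delta> by simp
  then have "(p + (p + 1)) / 2 \<in> T" by (simp add: field_simps)
  then have E: "closed_segment p (p + 1) edge_of T" by (rule edge_midpoint_tile[OF e T(1)])
  obtain v where v: "T = para p 1 v" "unit_frame 1 v"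
    using edge_of_rhombus[OF tile_rhombus[OF T(1)] E] by auto
  have D: "Im (cnj 1 * v) \<noteq> 0" using v(2) by (rule unit_frame_Im)
  obtain s t where st: "0 \<le> t" "?y = p + (of_real s * 1 + of_real t * v)"
    using T(2) v(1) mem_para[OF D] by auto
  have "Im ?y = Im (p + (of_real s * 1 + of_real t * v))" using st(2) by (rule arg_cong)
  then have "\<epsilon> * \<delta> = t * Im v" by simp
  then have "\<epsilon> * \<epsilon> * \<delta> = t * (\<epsilon> * Im v)" by (simp add: mult.assoc mult.left_commute)
  moreover have "\<epsilon> * \<epsilon> = 1" using \<epsilon> by auto
  ultimately have "0 < t * (\<epsilon> * Im v)" using \<delta> by simp
  then have "\<epsilon> * Im v > 0" using st(1) by (simp add: zero_less_mult_iff)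
  then show thesis using that v T(1) by blast
qed

text \<open>A tile with horizontal sides has height \<open>\<bar>Im v\<bar>\<close>, which is at least the radius of the
  inscribed disc.\<close>

lemma tile_heights_bounded_below:
  obtains \<rho> where "\<rho> > 0" "\<And>p v. para p 1 v \<in> \<Lambda> \<Longrightarrow> unit_frame 1 v \<Longrightarrow> \<rho> \<le> \<bar>Im v\<bar>"
proof -
  obtain \<rho> c where \<rho>: "\<rho> > 0" and c: "\<And>T. T \<in> \<Lambda> \<Longrightarrow> ball (c T) \<rho> \<subseteq> T"
    using inscribed_balls by blast
  have "\<rho> \<le> \<bar>Im v\<bar>" if T: "para p 1 v \<in> \<Lambda>" "unit_frame 1 v" for p v
  proof -
    let ?c = "c (para p 1 v)"
    have D: "Im (cnj 1 * v) \<noteq> 0" using T(2) by (rule unit_frame_Im)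
    have "?c + of_real (\<rho>/2) * \<i> \<in> para p 1 v" "?c - of_real (\<rho>/2) * \<i> \<in> para p 1 v"
      using c[OF T(1)] \<rho> by (auto simp: subset_iff dist_norm norm_mult)
    then obtain s t s' t' where st: "0 \<le> t" "t \<le> 1" "0 \<le> t'" "t' \<le> 1"
      "?c + of_real (\<rho>/2) * \<i> = p + (of_real s * 1 + of_real t * v)"
      "?c - of_real (\<rho>/2) * \<i> = p + (of_real s' * 1 + of_real t' * v)"
      unfolding mem_para[OF D] by blast
    have "Im (?c + of_real (\<rho>/2) * \<i>) = Im (p + (of_real s * 1 + of_real t * v))"
      "Im (?c - of_real (\<rho>/2) * \<i>) = Im (p + (of_real s' * 1 + of_real t' * v))"
      using st(5,6) by (simp_all only:)
    then have "\<rho> = (t - t') * Im v" by (simp add: algebra_simps)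
    then have "\<rho> = \<bar>t - t'\<bar> * \<bar>Im v\<bar>" using \<rho> by (metis abs_mult abs_of_pos)
    also have "\<dots> \<le> 1 * \<bar>Im v\<bar>" using st by (intro mult_right_mono) auto
    finally show ?thesis by simp
  qed
  then show thesis using that \<rho> by blast
qed

text \<open>A tile either has horizontal sides, and then lies on a track, or all its sides are slanted.\<close>

lemma tile_horizontal_cases:
  assumes "T \<in> \<Lambda>"
  obtains (track) p v where "T = para p 1 v" "unit_frame 1 v"
    | (plain) p u v where "T = para p u v" "unit_frame u v" "u \<noteq> 1" "u \<noteq> -1" "v \<noteq> 1" "v \<noteq> -1"
proof -
  obtain p u v where T: "T = para p u v" "unit_frame u v" using tile_para[OF assms] .
  have T': "T = para p v u" "unit_frame v u" using T by (simp_all add: para_commute unit_frame_commute)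
  have neg: "T = para (q - 1) 1 w \<and> unit_frame 1 w" if "T = para q (-1) w" "unit_frame (-1) w" for q w
    using that para_shift[of q "-1" w] unit_frame_minus[of 1 w] by simp
  show thesis
  proof (cases "u = 1 \<or> v = 1 \<or> u = -1 \<or> v = -1")
    case True
    then show ?thesis using T T' neg track by metis
  next
    case False
    then show ?thesis using T plain by blast
  qed
qed

end

text \<open>The number of horizontal unit steps to the right in a step \<open>d\<close>.\<close>

definition horizontal_sign :: "complex \<Rightarrow> int" where
  "horizontal_sign d = (if d = 1 then 1 else if d = -1 then -1 else 0)"

lemma horizontal_sign_minus: "horizontal_sign (- d) = - horizontal_sign d"
  by (auto simp: horizontal_sign_def minus_equation_iff[of d])

text \<open>The level counts the horizontal steps to the right along any path from a fixed vertex, steps to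
  the left counting negatively. It is determined up to an additive constant.\<close>

locale levelled_tiling = rhombic_tiling +
  fixes level :: "complex \<Rightarrow> int"
  assumes level_edge: "(a, b) \<in> edges \<Lambda> \<Longrightarrow> level b = level a + horizontal_sign (b - a)"

lemma (in rhombic_tiling) level_exists:
  obtains level where "levelled_tiling \<Lambda> level"
proof -
  interpret transport \<Lambda> "\<lambda>a b s. s + horizontal_sign (b - a)"
  proof
    show "s + horizontal_sign (b - a) + horizontal_sign (a - b) = s" for a b s
      using horizontal_sign_minus[of "b - a"] by simp
  qed (simp add: add_ac)
  obtain T p u v where "T \<in> \<Lambda>" "T = para p u v" "unit_frame u v"
    using tile_cover[of 0] tile_para by metis
  then have "p \<in> verts \<Lambda>" using para_edges(1) edges_verts(1) by blast
  then obtain l :: "complex \<Rightarrow> int" where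
    "\<And>a b. (a, b) \<in> edges \<Lambda> \<Longrightarrow> l b = l a + horizontal_sign (b - a)"
    using potential_exists[of p 0] by metis
  then have "levelled_tiling \<Lambda> l" by unfold_locales
  then show thesis by (rule that)
qed

context levelled_tiling
begin

lemma level_right: "(p, p + 1) \<in> edges \<Lambda> \<Longrightarrow> level (p + 1) = level p + 1"
  using level_edge[of p "p + 1"] by (simp add: horizontal_sign_def)

lemma level_slanted: "(a, b) \<in> slanted\<^sup>* \<Longrightarrow> level b = level a"
  by (induction rule: rtrancl_induct) (use level_edge in \<open>auto simp: slanted_def horizontal_sign_def\<close>)

text \<open>An affine function on the plane whose values at the corners of \<open>T\<close> are their levels. Affinity is
  required in the form of compatibility with affine combinations.\<close>

definition interpolates :: "complex set \<Rightarrow> (complex \<Rightarrow> real) \<Rightarrow> bool" where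
  "interpolates T A \<longleftrightarrow>
     (\<forall>x y r. A ((1 - r) *\<^sub>R x + r *\<^sub>R y) = (1 - r) * A x + r * A y) \<and>
     (\<forall>a. a extreme_point_of T \<longrightarrow> A a = level a)"

lemma interpolates_agree:
  assumes "T \<in> \<Lambda>" "T' \<in> \<Lambda>" "interpolates T A" "interpolates T' B" "x \<in> T" "x \<in> T'"
  shows "A x = B x"
proof -
  let ?F = "T \<inter> T'"
  have f: "?F face_of T" "?F face_of T'"
    using tile_Int_face[OF assms(1,2)] tile_Int_face[OF assms(2,1)] by (simp_all add: Int_commute)
  have c: "compact ?F" "convex ?F"
    using face_of_imp_compact[OF tile_convex tile_compact f(1)] assms(1) face_of_imp_convex[OF f(1)] by auto
  \<comment> \<open>both interpolations agree on a convex set that contains the extreme points of the common face\<close>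
  have "convex {x. A x = B x}"
    unfolding convex_alt using assms(3,4) by (simp add: interpolates_def)
  moreover have "{x. x extreme_point_of ?F} \<subseteq> {x. A x = B x}"
  proof
    fix a assume "a \<in> {x. x extreme_point_of ?F}"
    then have "a extreme_point_of T" "a extreme_point_of T'"
      using extreme_point_of_face[OF f(1)] extreme_point_of_face[OF f(2)] by blast+
    then show "a \<in> {x. A x = B x}" using assms(3,4) by (simp add: interpolates_def)
  qed
  ultimately have "convex hull {x. x extreme_point_of ?F} \<subseteq> {x. A x = B x}" by (rule hull_minimal[rotated])
  then show ?thesis using Krein_Milman_Minkowski[OF c] assms(5,6) by blast
qed

text \<open>The piecewise affine extension of the level to the plane.\<close>

definition height :: "complex \<Rightarrow> real" where
  "height x = (SOME h. \<exists>T\<in>\<Lambda>. \<exists>A. interpolates T A \<and> x \<in> T \<and> h = A x)"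

lemma height_eq:
  assumes "T \<in> \<Lambda>" "interpolates T A" "x \<in> T"
  shows "height x = A x"
  unfolding height_def
proof (rule some_equality)
  show "\<exists>T\<in>\<Lambda>. \<exists>B. interpolates T B \<and> x \<in> T \<and> A x = B x" using assms by blast
  show "h = A x" if "\<exists>T\<in>\<Lambda>. \<exists>A. interpolates T A \<and> x \<in> T \<and> h = A x" for h
    using that interpolates_agree assms by blast
qed

lemma height_track:
  fixes s t :: real
  assumes T: "para p 1 v \<in> \<Lambda>" "unit_frame 1 v" and "0 \<le> s" "s \<le> 1" "0 \<le> t" "t \<le> 1"
  shows "height (p + of_real s + of_real t * v) = level p + s"
proof -
  have D: "Im (cnj 1 * v) \<noteq> 0" using T(2) by (rule unit_frame_Im)
  then have D': "Im v \<noteq> 0" by simp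
  define A where "A x = level p + Im (cnj v * (x - p)) / Im (cnj v)" for x
  have A: "A (p + of_real s + of_real t * v) = level p + s" for s t :: real
    using D' by (simp add: A_def field_simps)
  note e = para_edges[OF T]
  have "v \<noteq> 1" "v \<noteq> -1" using D' by auto
  then have lv: "level (p + 1) = level p + 1" "level (p + v) = level p" "level (p + 1 + v) = level p + 1"
    using level_edge[OF e(1)] level_edge[OF e(2)] level_edge[OF e(3)] by (simp_all add: horizontal_sign_def)
  have "interpolates (para p 1 v) A"
    unfolding interpolates_def
  proof (intro conjI allI impI)
    show "A ((1 - r) *\<^sub>R x + r *\<^sub>R y) = (1 - r) * A x + r * A y" for x y r
      using D' by (simp add: A_def field_simps)
    fix a assume "a extreme_point_of para p 1 v"
    then have "a \<in> {p, p + 1, p + 1 + v, p + v}" using extreme_point_of_para[OF T(2)] by blast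
    then show "A a = level a"
      using A[of 0 0] A[of 1 0] A[of 0 1] A[of 1 1] lv by auto
  qed
  moreover have "p + of_real s + of_real t * v \<in> para p 1 v"
    unfolding mem_para[OF D] using assms(3-6) by (intro exI[of _ s] exI[of _ t]) (simp add: add.assoc)
  ultimately show ?thesis using height_eq[OF T(1)] A by simp
qed

lemma height_plain:
  assumes T: "para p u v \<in> \<Lambda>" "unit_frame u v" "u \<noteq> 1" "u \<noteq> -1" "v \<noteq> 1" "v \<noteq> -1"
    and x: "x \<in> para p u v"
  shows "height x = level p"
proof -
  note e = para_edges[OF T(1,2)]
  have lv: "level (p + u) = level p" "level (p + v) = level p" "level (p + u + v) = level p"
    using level_edge[OF e(1)] level_edge[OF e(2)] level_edge[OF e(3)] T(3-6) by (simp_all add: horizontal_sign_def)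
  have "interpolates (para p u v) (\<lambda>_. level p)"
    unfolding interpolates_def
    using extreme_point_of_para[OF T(2)] lv by (auto simp: algebra_simps)
  then show ?thesis using height_eq[OF T(1) _ x] by simp
qed

text \<open>On a track tile the height has slope 1 in the horizontal direction; on every other tile it is a
  constant integer.\<close>

lemma height_horizontal_in_tile:
  assumes "T \<in> \<Lambda>" "y \<in> T" "y + of_real s \<in> T"
  shows "height (y + of_real s) = height y + s \<or> height (y + of_real s) = height y \<and> height y \<in> \<int>"
  using assms(1)
proof (cases rule: tile_horizontal_cases)
  case (track p v)
  have D: "Im (cnj 1 * v) \<noteq> 0" using track(2) by (rule unit_frame_Im)
  obtain a b where ab: "0 \<le> a" "a \<le> 1" "0 \<le> b" "b \<le> 1" "y = p + (of_real a * 1 + of_real b * v)"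
    using assms(2) mem_para[OF D] track(1) by auto
  obtain a' b' where ab': "0 \<le> a'" "a' \<le> 1" "0 \<le> b'" "b' \<le> 1" "y + of_real s = p + (of_real a' * 1 + of_real b' * v)"
    using assms(3) mem_para[OF D] track(1) by auto
  have "of_real (a + s) * 1 + of_real b * v = of_real a' * 1 + of_real b' * v"
    using ab(5) ab'(5) by (simp add: algebra_simps)
  from frame_coords_unique(1)[OF D this] have "a + s = a'" .
  moreover have "height y = level p + a" "height (y + of_real s) = level p + a'"
    using height_track[of p v a b] height_track[of p v a' b'] track assms(1) ab ab' by (simp_all add: add.assoc)
  ultimately show ?thesis by simp
next
  case (plain p u v)
  then show ?thesis using height_plain[of p u v] assms by auto
qed

lemma height_mono:
  assumes "0 \<le> s"
  shows "height x \<le> height (x + of_real s)"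
proof -
  have "height (x + of_real 0) \<le> height (x + of_real s)"
    using assms
  proof (rule Bolzano[of 0 s "\<lambda>a b. height (x + of_real a) \<le> height (x + of_real b)"])
    fix c :: real
    let ?c = "x + of_real c"
    \<comment> \<open>points of the line near \<open>?c\<close> lie in tiles that contain \<open>?c\<close>\<close>
    have near: "height (x + of_real a) \<le> height ?c \<and> height ?c \<le> height (x + of_real b)"
      if "a \<le> c" "c \<le> b" "b - a < rad ?c" for a b
    proof -
      have d: "dist ?c (x + of_real a) < rad ?c" "dist ?c (x + of_real b) < rad ?c"
        using that by (simp_all add: dist_norm flip: of_real_diff)
      obtain T where T: "T \<in> \<Lambda>" "x + of_real a \<in> T" using tile_cover by metis
      obtain T' where T': "T' \<in> \<Lambda>" "x + of_real b \<in> T'" using tile_cover by metis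
      have e: "x + of_real a + of_real (c - a) = ?c" "?c + of_real (b - c) = x + of_real b" by simp_all
      show ?thesis
        using height_horizontal_in_tile[of T "x + of_real a" "c - a"] star[OF T d(1)] T
          height_horizontal_in_tile[of T' ?c "b - c"] star[OF T' d(2)] T' that(1,2) unfolding e by auto
    qed
    show "\<exists>d>0. \<forall>a b. a \<le> c \<and> c \<le> b \<and> b - a < d \<longrightarrow> height (x + of_real a) \<le> height (x + of_real b)"
      by (rule exI[of _ "rad ?c"]) (use rad_pos near in \<open>meson order_trans\<close>)
  qed auto
  then show ?thesis by simp
qed

lemma height_strict_mono:
  assumes "0 < s" "height x \<notin> \<int>"
  shows "height x < height (x + of_real s)"
proof -
  define \<epsilon> where "\<epsilon> = min s (rad x / 2)"
  have \<epsilon>: "0 < \<epsilon>" "\<epsilon> \<le> s" "\<epsilon> < rad x" using assms(1) rad_pos[of x] by (auto simp: \<epsilon>_def min_def)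
  obtain T where T: "T \<in> \<Lambda>" "x + of_real \<epsilon> \<in> T" using tile_cover by metis
  have "x \<in> T" by (rule star[OF T]) (use \<epsilon> in \<open>simp add: dist_norm\<close>)
  then have "height (x + of_real \<epsilon>) = height x + \<epsilon>"
    using height_horizontal_in_tile[OF T(1) _ T(2)] assms(2) by blast
  moreover have "height (x + of_real \<epsilon>) \<le> height (x + of_real \<epsilon> + of_real (s - \<epsilon>))"
    by (rule height_mono) (use \<epsilon> in simp)
  moreover have "x + of_real \<epsilon> + of_real (s - \<epsilon>) = x + of_real s" by simp
  ultimately show ?thesis using \<epsilon> by simp
qed

text \<open>Follow the track of the edge \<open>(p, p + 1)\<close> upwards (\<open>\<epsilon> = 1\<close>) or downwards (\<open>\<epsilon> = -1\<close>). Each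
  tile gains at least \<open>\<rho>\<close> in height, so the height \<open>Y\<close> is reached within the first \<open>m + 1\<close>
  tiles.\<close>

lemma track_reaches:
  assumes \<epsilon>: "\<epsilon> = 1 \<or> \<epsilon> = (-1::real)"
    and \<rho>: "\<rho> > 0" "\<And>p v. para p 1 v \<in> \<Lambda> \<Longrightarrow> unit_frame 1 v \<Longrightarrow> \<rho> \<le> \<bar>Im v\<bar>"
    and "(p, p + 1) \<in> edges \<Lambda>" "0 \<le> \<epsilon> * (Y - Im p)" "\<epsilon> * (Y - Im p) \<le> real m * \<rho>"
  shows "\<exists>q v t. (p, q) \<in> slanted\<^sup>* \<and> para q 1 v \<in> \<Lambda> \<and> unit_frame 1 v \<and> 0 \<le> t \<and> t \<le> 1
    \<and> Im (q + of_real t * v) = Y"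
  using assms(4-6)
proof (induction m arbitrary: p)
  case (Suc m)
  obtain v where v: "para p 1 v \<in> \<Lambda>" "unit_frame 1 v" "\<epsilon> * Im v > 0"
    using tile_on_side[OF Suc.prems(1) \<epsilon>] .
  have big: "\<rho> \<le> \<epsilon> * Im v" using \<rho>(2)[OF v(1,2)] v(3) \<epsilon> by auto
  show ?case
  proof (cases "\<epsilon> * (Y - Im p) \<le> \<epsilon> * Im v")
    case True
    define t where "t = (\<epsilon> * (Y - Im p)) / (\<epsilon> * Im v)"
    have "0 \<le> t" "t \<le> 1" using True Suc.prems(2) v(3) \<epsilon> by (auto simp: t_def field_simps)
    moreover have "Im (p + of_real t * v) = Y" using v(3) \<epsilon> by (auto simp: t_def)
    ultimately show ?thesis using v by blast
  next
    case False
    note e = para_edges[OF v(1,2)]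
    have e': "(p + v, p + v + 1) \<in> edges \<Lambda>" using e(4) by (simp add: add_ac)
    have "Im v \<noteq> 0" using v(3) by auto
    then have "(p, p + v) \<in> slanted" using e(2) by (auto simp: slanted_def)
    moreover have "\<exists>q w t. (p + v, q) \<in> slanted\<^sup>* \<and> para q 1 w \<in> \<Lambda> \<and> unit_frame 1 w \<and> 0 \<le> t \<and> t \<le> 1
        \<and> Im (q + of_real t * w) = Y"
      by (rule Suc.IH[OF e']) (use False Suc.prems(3) big in \<open>simp_all add: algebra_simps\<close>)
    ultimately show ?thesis using converse_rtrancl_into_rtrancl[of p "p + v" slanted] by metis
  qed
next
  case 0
  obtain v where v: "para p 1 v \<in> \<Lambda>" "unit_frame 1 v" "\<epsilon> * Im v > 0"
    using tile_on_side[OF 0(1) \<epsilon>] .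
  have "Im p = Y" using 0 \<epsilon> by auto
  then show ?case using v by (intro exI[of _ p] exI[of _ v] exI[of _ 0]) simp
qed

text \<open>Let the track of the first edge reach the height of the second. Its centre line there and the
  midpoint of the second edge lie on one horizontal line and have the same height, a half-integer;
  by strict monotonicity they coincide, so that the second edge belongs to the track of the first.\<close>

lemma track_unique:
  assumes e: "(p, p + 1) \<in> edges \<Lambda>" and e': "(p', p' + 1) \<in> edges \<Lambda>" and lv: "level p = level p'"
  shows "(p, p') \<in> slanted\<^sup>*"
proof -
  obtain \<rho> where \<rho>: "\<rho> > 0" "\<And>p v. para p 1 v \<in> \<Lambda> \<Longrightarrow> unit_frame 1 v \<Longrightarrow> \<rho> \<le> \<bar>Im v\<bar>"
    by (rule tile_heights_bounded_below) blast
  define \<epsilon> :: real where "\<epsilon> = (if Im p \<le> Im p' then 1 else -1)"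
  have \<epsilon>: "\<epsilon> = 1 \<or> \<epsilon> = -1" "0 \<le> \<epsilon> * (Im p' - Im p)" by (auto simp: \<epsilon>_def)
  obtain m where "\<epsilon> * (Im p' - Im p) \<le> real m * \<rho>"
    using reals_Archimedean3[OF \<rho>(1)] less_imp_le by blast
  then obtain q v t where q: "(p, q) \<in> slanted\<^sup>*" "para q 1 v \<in> \<Lambda>" "unit_frame 1 v" "0 \<le> t" "t \<le> 1"
    "Im (q + of_real t * v) = Im p'"
    using track_reaches[of \<epsilon> \<rho> p "Im p'" m] \<epsilon> \<rho> e by blast
  have D: "Im (cnj 1 * v) \<noteq> 0" using q(3) by (rule unit_frame_Im)
  let ?x = "q + of_real (1/2) + of_real t * v" and ?m = "p' + of_real (1/2)"
  have lq: "level q = level p'" using level_slanted[OF q(1)] lv by simp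
  have hx: "height ?x = level p' + 1/2" using height_track[OF q(2,3), of "1/2" t] q(4,5) lq by simp
  obtain v' where v': "para p' 1 v' \<in> \<Lambda>" "unit_frame 1 v'" using tile_on_side[OF e', of 1] by blast
  have hm: "height ?m = level p' + 1/2" using height_track[OF v', of "1/2" 0] by simp
  have half: "real_of_int (level p') + 1/2 \<notin> \<int>"
  proof
    assume "real_of_int (level p') + 1/2 \<in> \<int>"
    then obtain k where "real_of_int (level p') + 1/2 = real_of_int k" by (elim Ints_cases)
    then have "real_of_int (2 * level p' + 1) = real_of_int (2 * k)" by simp
    then have "2 * level p' + 1 = 2 * k" by (simp only: of_int_eq_iff)
    then show False by presburger
  qed
  define s where "s = Re ?m - Re ?x"
  have ms: "?m = ?x + of_real s" using q(6) by (simp add: complex_eq_iff s_def)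
  then have xs: "?x = ?m + of_real (- s)" by simp
  have "\<not> s > 0" using height_strict_mono[of s ?x] hx hm half ms by (metis less_irrefl)
  moreover have "\<not> - s > 0" using height_strict_mono[of "- s" ?m] hx hm half xs by (metis less_irrefl)
  ultimately have "?m = ?x" using ms by simp
  moreover have "?x \<in> para q 1 v"
    unfolding mem_para[OF D] using q(4,5) by (intro exI[of _ "1/2"] exI[of _ t]) (simp add: add.assoc)
  moreover have "?m = (p' + (p' + 1)) / 2" by (simp add: field_simps)
  ultimately have "(p' + (p' + 1)) / 2 \<in> para q 1 v" by metis
  then have "closed_segment p' (p' + 1) edge_of para q 1 v"
    by (rule edge_midpoint_tile[OF e' q(2)])
  then have "p' \<in> {q, q + 1, q + 1 + v, q + v}"
    using edge_endpoints_extreme(1) extreme_point_of_para[OF q(3)] by blast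
  moreover note pe = para_edges[OF q(2,3)]
  have "v \<noteq> 1" "v \<noteq> -1" using D by auto
  then have "level (q + 1) = level q + 1" "level (q + 1 + v) = level q + 1" and sl: "(q, q + v) \<in> slanted"
    using level_edge[OF pe(1)] level_edge[OF pe(3)] pe(2) by (simp_all add: horizontal_sign_def slanted_def)
  ultimately have "p' = q \<or> p' = q + v" using lq by auto
  then show ?thesis using q(1) sl by (auto intro: rtrancl_into_rtrancl)
qed

end

locale escaping_levelled_tiling = escaping_tiling + levelled_tiling
begin

theorem same_level_connected:
  assumes "a \<in> verts \<Lambda>" "b \<in> verts \<Lambda>" "level a = level b"
  shows "(a, b) \<in> slanted\<^sup>*"
proof -
  obtain a' where a': "(a, a') \<in> slanted\<^sup>*" "(a', a' + 1) \<in> edges \<Lambda>" using escape_step assms(1) .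
  obtain b' where b': "(b, b') \<in> slanted\<^sup>*" "(b', b' + 1) \<in> edges \<Lambda>" using escape_step assms(2) .
  have "(a', b') \<in> slanted\<^sup>*"
    using track_unique[OF a'(2) b'(2)] level_slanted[OF a'(1)] level_slanted[OF b'(1)] assms(3) by simp
  then show ?thesis using a'(1) slanted_sym[OF b'(1)] by (meson rtrancl_trans)
qed

end

section \<open>Surjectivity of the shift operator and the exponentials\<close>

context rhombic_tiling
begin

text \<open>The regularised relation: the coefficient of \<open>g a - g b\<close> is a real number \<open>c > 1\<close> instead of 1.
  As edges have length 1, it can be solved for the value at either endpoint, and it is trivial around
  a tile by the discrete Cauchy-Riemann equation.\<close>

lemma regularised_solution:
  assumes h: "h \<in> DA \<Lambda>" and c: "c > (1::real)" and w: "w \<in> verts \<Lambda>"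
  obtains g where "g w = 0" "\<And>a b. (a, b) \<in> edges \<Lambda> \<Longrightarrow>
    2 * (h b - h a) = of_real c * (g a - g b) + (g a + g b) * (b - a)"
proof -
  have ne: "of_real c - d \<noteq> 0" "of_real c + d \<noteq> 0" if "norm d = 1" for d :: complex
  proof -
    have "norm (of_real c :: complex) = c" using c by simp
    then have "of_real c \<noteq> d" "of_real c \<noteq> - d" using that c by (metis less_irrefl norm_minus_cancel)+
    then show "of_real c - d \<noteq> 0" "of_real c + d \<noteq> 0" by (auto simp: add_eq_0_iff2)
  qed
  let ?t = "\<lambda>a b s. ((of_real c + (b - a)) * s - 2 * (h b - h a)) / (of_real c - (b - a))"
  interpret transport \<Lambda> ?t
  proof
    fix a b s assume "(a, b) \<in> edges \<Lambda>"
    then have n: "of_real c - (b - a) \<noteq> 0" "of_real c + (b - a) \<noteq> 0" using norm_edge ne by blast+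
    have "?t b a (?t a b s) = ((of_real c - (b - a)) * ?t a b s - 2 * (h a - h b)) / (of_real c + (b - a))"
      by (simp add: algebra_simps)
    also have "(of_real c - (b - a)) * ?t a b s = (of_real c + (b - a)) * s - 2 * (h b - h a)"
      using n by simp
    also have "(\<dots> - 2 * (h a - h b)) / (of_real c + (b - a)) = s" using n by (simp add: field_simps)
    finally show "?t b a (?t a b s) = s" .
  next
    fix p u v s assume T: "para p u v \<in> \<Lambda>" "unit_frame u v"
    have n: "of_real c - u \<noteq> 0" "of_real c - v \<noteq> 0"
      using T(2) ne by (auto simp: unit_frame_def)
    let ?c = "of_real c :: complex"
    have d: "p + u - p = u" "p + v - p = v" "p + u + v - (p + u) = v" "p + u + v - (p + v) = u" by simp_all
    have combine: "(C * (X / B) - Y) / D = (C * X - B * Y) / (B * D)" if "B \<noteq> 0" "D \<noteq> 0" for B C D X Y :: complex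
      using that by (simp add: field_simps)
    have "(?c + v) * ((?c + u) * s - 2 * (h (p + u) - h p)) - (?c - u) * (2 * (h (p + u + v) - h (p + u))) =
        (?c + u) * ((?c + v) * s - 2 * (h (p + v) - h p)) - (?c - v) * (2 * (h (p + u + v) - h (p + v)))"
      using DA_tile[OF h T] by algebra
    then show "?t (p + u) (p + u + v) (?t p (p + u) s) = ?t (p + v) (p + u + v) (?t p (p + v) s)"
      unfolding d combine[OF n] combine[OF n(2,1)] by (simp only: mult.commute)
  qed
  obtain g where g: "g w = 0" "\<And>a b. (a, b) \<in> edges \<Lambda> \<Longrightarrow> g b = ?t a b (g a)"
    using potential_exists[OF w, of 0] by metis
  have "2 * (h b - h a) = of_real c * (g a - g b) + (g a + g b) * (b - a)" if e: "(a, b) \<in> edges \<Lambda>" for a b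
  proof -
    have "of_real c - (b - a) \<noteq> 0" using norm_edge[OF e] ne by blast
    then have "(of_real c - (b - a)) * g b = (of_real c + (b - a)) * g a - 2 * (h b - h a)"
      using g(2)[OF e] by simp
    then show ?thesis by (simp add: algebra_simps)
  qed
  then show thesis using that g(1) by blast
qed

end

context escaping_levelled_tiling
begin

lemma level_up:
  assumes "a \<in> verts \<Lambda>"
  obtains a' where "(a, a') \<in> slanted\<^sup>*" "(a', a' + 1) \<in> edges \<Lambda>" "level a' = level a" "level (a' + 1) = level a + 1"
  using escape_step[OF assms] level_slanted level_right by metis

lemma slanted_edge: "(a, b) \<in> slanted \<Longrightarrow> (a, b) \<in> edges \<Lambda>"
  by (simp add: slanted_def)

text \<open>As \<open>c\<close> tends to 1, the regularised solutions that vanish at \<open>w\<close> converge on all levels up to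
  that of \<open>w\<close>: the limit passes along slanted steps and along horizontal steps to the left.\<close>

lemma solution_up_to_level:
  assumes h: "h \<in> DA \<Lambda>" and w: "w \<in> verts \<Lambda>"
  obtains g where "\<And>a b. (a, b) \<in> edges \<Lambda> \<Longrightarrow> level a \<le> level w \<Longrightarrow> level b \<le> level w \<Longrightarrow>
    2 * (h b - h a) = (g a - g b) + (g a + g b) * (b - a)"
proof -
  have "\<exists>g. g w = 0 \<and> (\<forall>a b. (a, b) \<in> edges \<Lambda> \<longrightarrow>
    2 * (h b - h a) = of_real c * (g a - g b) + (g a + g b) * (b - a))" if "c > 1" for c :: real
    by (rule regularised_solution[OF h that w]) blast
  then obtain G :: "real \<Rightarrow> complex \<Rightarrow> complex" where Gw: "\<And>c. c > 1 \<Longrightarrow> G c w = 0" and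
    G: "\<And>c a b. c > 1 \<Longrightarrow> (a, b) \<in> edges \<Lambda> \<Longrightarrow>
      2 * (h b - h a) = of_real c * (G c a - G c b) + (G c a + G c b) * (b - a)" by metis
  let ?conv = "\<lambda>a. \<exists>l. ((\<lambda>c. G c a) \<longlongrightarrow> l) (at_right 1)"
  have c1: "((\<lambda>c. of_real c :: complex) \<longlongrightarrow> 1) (at_right (1::real))"
    by (rule tendsto_eq_intros tendsto_ident_at)+ simp
  have ev: "\<forall>\<^sub>F c in at_right 1. c > (1::real)" by (simp add: eventually_at_right_less)
  have step: "?conv b" if e: "(a, b) \<in> edges \<Lambda>" and "b - a \<noteq> 1" and ca: "?conv a" for a b
  proof -
    obtain l where l: "((\<lambda>c. G c a) \<longlongrightarrow> l) (at_right 1)" using ca by blast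
    have *: "G c b = ((of_real c + (b - a)) * G c a - 2 * (h b - h a)) / (of_real c - (b - a))" if c: "c > 1" for c
    proof -
      have "norm (of_real c :: complex) \<noteq> norm (b - a)" using norm_edge[OF e] c by simp
      then have "of_real c - (b - a) \<noteq> 0" by (metis eq_iff_diff_eq_0)
      moreover have "G c b * (of_real c - (b - a)) = (of_real c + (b - a)) * G c a - 2 * (h b - h a)"
        using G[OF c e] by (simp add: algebra_simps)
      ultimately show ?thesis by (simp add: nonzero_eq_divide_eq)
    qed
    have "((\<lambda>c. ((of_real c + (b - a)) * G c a - 2 * (h b - h a)) / (of_real c - (b - a)))
        \<longlongrightarrow> ((1 + (b - a)) * l - 2 * (h b - h a)) / (1 - (b - a))) (at_right 1)"
      using \<open>b - a \<noteq> 1\<close> by (intro tendsto_intros c1 l) auto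
    then have "((\<lambda>c. G c b) \<longlongrightarrow> ((1 + (b - a)) * l - 2 * (h b - h a)) / (1 - (b - a))) (at_right 1)"
      by (rule Lim_transform_eventually) (use ev * in \<open>auto elim: eventually_mono\<close>)
    then show ?thesis by blast
  qed
  \<comment> \<open>slanted steps differ from 1\<close>
  have along: "?conv b" if "(a, b) \<in> slanted\<^sup>*" "?conv a" for a b
    using that by (induction rule: rtrancl_induct) (auto simp: slanted_def intro: step)
  have conv: "?conv a" if "a \<in> verts \<Lambda>" "level a = level w - int j" for a j
    using that
  proof (induction j arbitrary: a)
    case 0
    have "((\<lambda>c. G c w) \<longlongrightarrow> 0) (at_right 1)"
      by (rule tendsto_eventually) (use ev Gw in \<open>auto elim: eventually_mono\<close>)
    then show ?case using along[OF same_level_connected[OF w, of a]] 0 by auto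
  next
    case (Suc j)
    obtain a' where a': "(a, a') \<in> slanted\<^sup>*" "(a', a' + 1) \<in> edges \<Lambda>" "level (a' + 1) = level a + 1"
      using level_up[OF Suc.prems(1)] by metis
    have "?conv (a' + 1)" by (rule Suc.IH) (use edges_verts(2)[OF a'(2)] a'(3) Suc.prems in auto)
    then have "?conv a'" using step[OF edges_sym[OF a'(2)]] by auto
    then show ?case using along[OF slanted_sym[OF a'(1)]] by blast
  qed
  have "?conv a" if "a \<in> verts \<Lambda>" "level a \<le> level w" for a
    using conv[OF that(1), of "nat (level w - level a)"] that(2) by simp
  then obtain g where g: "\<And>a. a \<in> verts \<Lambda> \<Longrightarrow> level a \<le> level w \<Longrightarrow> ((\<lambda>c. G c a) \<longlongrightarrow> g a) (at_right 1)"
    by metis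
  have "2 * (h b - h a) = (g a - g b) + (g a + g b) * (b - a)"
    if e: "(a, b) \<in> edges \<Lambda>" and la: "level a \<le> level w" and lb: "level b \<le> level w" for a b
  proof -
    note ga = g[OF edges_verts(1)[OF e] la] and gb = g[OF edges_verts(2)[OF e] lb]
    have "((\<lambda>c. of_real c * (G c a - G c b) + (G c a + G c b) * (b - a))
        \<longlongrightarrow> 1 * (g a - g b) + (g a + g b) * (b - a)) (at_right 1)"
      by (intro tendsto_intros c1 ga gb)
    moreover have "((\<lambda>c. of_real c * (G c a - G c b) + (G c a + G c b) * (b - a))
        \<longlongrightarrow> 2 * (h b - h a)) (at_right 1)"
      by (rule tendsto_eventually) (use ev G[OF _ e] in \<open>auto elim!: eventually_mono\<close>)
    ultimately show ?thesis using tendsto_unique[OF trivial_limit_at_right_real] by fastforce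
  qed
  then show thesis by (rule that)
qed

text \<open>Solutions exist up to every level. A solution up to level \<open>m\<close> is determined on the levels below
  \<open>m\<close>, so these solutions glue.\<close>

theorem shift_rel_solvable:
  assumes h: "h \<in> DA \<Lambda>" and z0: "z0 \<in> verts \<Lambda>"
  obtains g where "shift_rel g h" "\<And>z. z \<notin> verts \<Lambda> \<Longrightarrow> g z = 0"
proof -
  have top: "\<exists>w. w \<in> verts \<Lambda> \<and> level w = level z0 + int j" for j
  proof (induction j)
    case 0 show ?case using z0 by auto
  next
    case (Suc j)
    then obtain w where w: "w \<in> verts \<Lambda>" "level w = level z0 + int j" by blast
    obtain w' where "(w', w' + 1) \<in> edges \<Lambda>" "level (w' + 1) = level w + 1" using level_up[OF w(1)] by metis
    then show ?case using w(2) edges_verts(2) by (intro exI[of _ "w' + 1"]) auto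
  qed
  define solves where "solves m g \<longleftrightarrow> (\<forall>a b. (a, b) \<in> edges \<Lambda> \<longrightarrow> level a \<le> m \<longrightarrow> level b \<le> m \<longrightarrow>
    2 * (h b - h a) = (g a - g b) + (g a + g b) * (b - a))" for m g
  have "\<exists>g. solves m g" for m
  proof -
    obtain w where w: "w \<in> verts \<Lambda>" "level w = level z0 + int (nat (m - level z0))" using top by blast
    obtain g where "\<And>a b. (a, b) \<in> edges \<Lambda> \<Longrightarrow> level a \<le> level w \<Longrightarrow> level b \<le> level w \<Longrightarrow>
      2 * (h b - h a) = (g a - g b) + (g a + g b) * (b - a)" using solution_up_to_level[OF h w(1)] by metis
    then have "solves m g" using w(2) by (auto simp: solves_def)
    then show ?thesis by blast
  qed
  then obtain G where G: "\<And>m. solves m (G m)" by metis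
  have agree: "G m a = G (level a + 1) a" if a: "a \<in> verts \<Lambda>" and m: "m \<ge> level a + 1" for m a
  proof -
    obtain a' where a': "(a, a') \<in> slanted\<^sup>*" "(a', a' + 1) \<in> edges \<Lambda>" "level a' = level a" "level (a' + 1) = level a + 1"
      using level_up[OF a] by metis
    have "2 * (h (a' + 1) - h a') = 2 * G k a'" if "k \<ge> level a + 1" for k
      using G[of k, unfolded solves_def, rule_format, OF a'(2)] a'(3,4) that by simp
    from this[of m] this[of "level a + 1"] m have eq: "G m a' = G (level a + 1) a'" by simp
    have "2 * (h y - h x) = (G k x - G k y) + (G k x + G k y) * (y - x)"
      if k: "k \<ge> level a + 1" and xy: "(x, y) \<in> slanted" "(a', x) \<in> slanted\<^sup>*" for k x y
    proof -
      have "level x = level a" using level_slanted[OF xy(2)] a'(3) by simp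
      moreover have "level y = level x" using level_slanted[of x y] xy(1) by blast
      ultimately show ?thesis using G[of k] slanted_edge[OF xy(1)] k by (simp add: solves_def)
    qed
    note rel = this
    show ?thesis
      by (rule slanted_propagates[OF slanted_sym[OF a'(1)] eq rel[OF m] rel[OF order_refl]])
  qed
  define g where "g a = (if a \<in> verts \<Lambda> then G (level a + 1) a else 0)" for a
  have "shift_rel g h"
    unfolding shift_rel_def
  proof (intro allI impI)
    fix a b assume e: "(a, b) \<in> edges \<Lambda>"
    note v = edges_verts(1)[OF e] edges_verts(2)[OF e]
    let ?m = "max (level a) (level b) + 1"
    have "g a = G ?m a" "g b = G ?m b" using v agree[of a ?m] agree[of b ?m] by (simp_all add: g_def)
    then show "2 * (h b - h a) = (g a - g b) + (g a + g b) * (b - a)"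
      using G[of ?m] e by (simp add: solves_def)
  qed
  then show thesis using that g_def by simp
qed

end

context escaping_tiling
begin

theorem Z_plus_surjective:
  assumes "h \<in> DA \<Lambda>" "0 \<in> verts \<Lambda>"
  obtains g where "shift_rel g h" "\<And>z. z \<notin> verts \<Lambda> \<Longrightarrow> g z = 0"
proof -
  obtain l where "levelled_tiling \<Lambda> l" using level_exists .
  then interpret levelled_tiling \<Lambda> l .
  interpret escaping_levelled_tiling \<Lambda> l ..
  show thesis using shift_rel_solvable[OF assms] that by metis
qed

text \<open>Along an edge, the exponential is multiplied by the factor of the product formula. Its
  numerator and denominator are nonzero as \<open>t \<notin> S_set \<Lambda>\<close>.\<close>

lemma exponential_exists:
  assumes "t \<notin> S_set \<Lambda>" "0 \<in> verts \<Lambda>"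
  obtains e where "e 0 = 1" "\<And>z. z \<notin> verts \<Lambda> \<Longrightarrow> e z = 0"
    "\<And>a b. (a, b) \<in> edges \<Lambda> \<Longrightarrow> e b = e a * ((2 + t * (1 + b - a)) / (2 + t * (1 + a - b)))"
proof -
  have ne: "2 + t * (1 + b - a) \<noteq> 0" if "(a, b) \<in> edges \<Lambda>" for a b
  proof
    assume "2 + t * (1 + b - a) = 0"
    then have "t * (1 + b - a) = -2" by (metis add_eq_0_iff)
    then show False using assms(1) that by (auto simp: S_set_def)
  qed
  let ?r = "\<lambda>d. (2 + t * (1 + d)) / (2 + t * (1 - d))"
  interpret transport \<Lambda> "\<lambda>a b s. s * ((2 + t * (1 + b - a)) / (2 + t * (1 + a - b)))"
  proof
    show "s * ((2 + t * (1 + b - a)) / (2 + t * (1 + a - b))) * ((2 + t * (1 + a - b)) / (2 + t * (1 + b - a))) = s"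
      if "(a, b) \<in> edges \<Lambda>" for a b s
      using ne[OF that] ne[OF edges_sym[OF that]] by simp
    fix p u v s :: complex
    have d: "1 + (p + u) - p = 1 + u" "1 + p - (p + u) = 1 - u" "1 + (p + v) - p = 1 + v" "1 + p - (p + v) = 1 - v"
      "1 + (p + u + v) - (p + u) = 1 + v" "1 + (p + u) - (p + u + v) = 1 - v"
      "1 + (p + u + v) - (p + v) = 1 + u" "1 + (p + v) - (p + u + v) = 1 - u" by simp_all
    show "s * ((2 + t * (1 + (p + u) - p)) / (2 + t * (1 + p - (p + u)))) *
        ((2 + t * (1 + (p + u + v) - (p + u))) / (2 + t * (1 + (p + u) - (p + u + v)))) =
      s * ((2 + t * (1 + (p + v) - p)) / (2 + t * (1 + p - (p + v)))) *
        ((2 + t * (1 + (p + u + v) - (p + v))) / (2 + t * (1 + (p + v) - (p + u + v))))"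
      unfolding d by (simp add: mult_ac)
  qed
  obtain F :: "complex \<Rightarrow> complex" where F: "F 0 = 1" "\<And>a b. (a, b) \<in> edges \<Lambda> \<Longrightarrow>
      F b = F a * ((2 + t * (1 + b - a)) / (2 + t * (1 + a - b)))"
    using potential_exists[OF assms(2), of 1] by metis
  show thesis
    by (rule that[of "\<lambda>z. if z \<in> verts \<Lambda> then F z else 0"])
      (use F assms(2) edges_verts in auto)
qed

end

theorem theorem4p1:
  fixes \<Lambda> :: "complex set set" and t :: complex
  assumes lattice: "rhombic_lattice \<Lambda>"
    and zero_vertex: "0 \<in> verts \<Lambda>"
    and escape: "\<forall>w\<in>verts \<Lambda>. \<exists>N z b. N \<ge> 1 \<and> is_path \<Lambda> N z w b \<and>
          (\<forall>n\<in>{1..N - 1}. z n - z (n - 1) \<noteq> 1 \<and> z n - z (n - 1) \<noteq> -1) \<and>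
          z N - z (N - 1) = 1"
    and t: "t \<notin> S_set \<Lambda>"
  shows "is_eigenvalue (DA \<Lambda>) (Z_minus \<Lambda>) t \<and>
         cfun.dim (eigenspace (DA \<Lambda>) (Z_minus \<Lambda>) t) = 1 \<and>
         eigenspace (DA \<Lambda>) (Z_minus \<Lambda>) t = cfun.span {e_fun \<Lambda> t} \<and>
         e_fun \<Lambda> t \<in> DA \<Lambda> \<and>
         e_fun \<Lambda> t 0 = 1 \<and>
         (\<forall>z\<in>verts \<Lambda>. z \<noteq> 0 \<longrightarrow>
            (\<forall>N \<gamma>. is_path \<Lambda> N \<gamma> 0 z \<longrightarrow>
               e_fun \<Lambda> t z =
                 (\<Prod>k=1..N. (2 + t * (1 + \<gamma> k - \<gamma> (k - 1))) / (2 + t * (1 + \<gamma> (k - 1) - \<gamma> k)))))"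
proof -
  interpret escaping_tiling \<Lambda> by unfold_locales (fact lattice, fact escape)
  obtain e :: "complex \<Rightarrow> complex" where e0: "e 0 = 1" and off: "\<And>z. z \<notin> verts \<Lambda> \<Longrightarrow> e z = 0"
    and e_step: "\<And>a b. (a, b) \<in> edges \<Lambda> \<Longrightarrow> e b = e a * ((2 + t * (1 + b - a)) / (2 + t * (1 + a - b)))"
    using exponential_exists[OF t zero_vertex] by metis
  have ne: "2 + t * (1 + a - b) \<noteq> 0" if "(a, b) \<in> edges \<Lambda>" for a b
  proof
    assume "2 + t * (1 + a - b) = 0"
    then have "t * (1 + a - b) = -2" by (metis add_eq_0_iff)
    then show False using t edges_sym[OF that] by (auto simp: S_set_def)
  qed
  have along: "e z = path_prod t N \<gamma>" if \<gamma>: "is_path \<Lambda> N \<gamma> 0 z" for N \<gamma> z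
  proof -
    have "e (\<gamma> n) = path_prod t n \<gamma>" if "n \<le> N" for n
      using that
    proof (induction n)
      case 0 then show ?case using \<gamma> e0 by (simp add: path_prod_def is_path_def)
    next
      case (Suc n)
      then have "(\<gamma> n, \<gamma> (Suc n)) \<in> edges \<Lambda>"
        using \<gamma> by (auto simp: is_path_def dest: bspec[of _ _ "Suc n"])
      from e_step[OF this] show ?case using Suc by (simp add: path_prod_def)
    qed
    then show ?thesis using \<gamma> by (auto simp: is_path_def)
  qed
  have e_eq: "e_fun \<Lambda> t = e"
  proof
    fix z
    consider "z \<notin> verts \<Lambda>" | "z = 0" | "z \<in> verts \<Lambda>" "z \<noteq> 0" by blast
    then show "e_fun \<Lambda> t z = e z"
    proof cases
      case 3
      obtain N \<gamma> where \<gamma>: "is_path \<Lambda> N \<gamma> 0 z"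
        using path_exists[OF verts_connected zero_vertex] zero_vertex 3(1) by metis
      have "(THE w. \<exists>N \<gamma>. is_path \<Lambda> N \<gamma> 0 z \<and> w = path_prod t N \<gamma>) = e z"
      proof (rule the_equality)
        show "\<exists>N \<gamma>. is_path \<Lambda> N \<gamma> 0 z \<and> e z = path_prod t N \<gamma>" using \<gamma> along by blast
        show "w = e z" if "\<exists>N \<gamma>. is_path \<Lambda> N \<gamma> 0 z \<and> w = path_prod t N \<gamma>" for w
          using that along by metis
      qed
      then show ?thesis using 3 by (simp add: e_fun_def)
    qed (use zero_vertex e0 off in \<open>simp_all add: e_fun_def\<close>)
  qed
  \<comment> \<open>the edge relation of \<open>Z_plus\<close> between \<open>t f\<close> and \<open>f\<close>\<close>
  have rel_iff: "2 * (f b - f a) = (t * f a - t * f b) + (t * f a + t * f b) * (b - a) \<longleftrightarrow>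
      f b = f a * ((2 + t * (1 + b - a)) / (2 + t * (1 + a - b)))" if "(a, b) \<in> edges \<Lambda>" for f :: "complex \<Rightarrow> complex" and a b
  proof -
    have "f b = f a * ((2 + t * (1 + b - a)) / (2 + t * (1 + a - b))) \<longleftrightarrow>
      f b * (2 + t * (1 + a - b)) = f a * (2 + t * (1 + b - a))"
      using ne[OF that] by (simp add: field_simps)
    also have "\<dots> \<longleftrightarrow> 2 * (f b - f a) = (t * f a - t * f b) + (t * f a + t * f b) * (b - a)"
      by (auto simp: algebra_simps)
    finally show ?thesis by blast
  qed
  have e_DA: "e \<in> DA \<Lambda>"
  proof (cases "t = 0")
    case True
    \<comment> \<open>here \<open>e x = e y\<close> along edges\<close>
    have "(e x + e y) / 2 * (y - x) = e y * y - e x * x" if "(x, y) \<in> edges \<Lambda>" for x y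
      using e_step[OF that] True by (simp add: algebra_simps)
    then show ?thesis using DA_if_primitive[of e "\<lambda>z. e z * z"] off by blast
  next
    case False
    have "(e x + e y) / 2 * (y - x) = (2 + t) / (2 * t) * e y - (2 + t) / (2 * t) * e x" if "(x, y) \<in> edges \<Lambda>" for x y
    proof -
      have "2 * (e y - e x) = (t * e x - t * e y) + (t * e x + t * e y) * (y - x)"
        using rel_iff[OF that] e_step[OF that] by blast
      then have "t * ((e x + e y) * (y - x)) = (2 + t) * (e y - e x)"
        by (simp add: algebra_simps)
      then have "(e x + e y) * (y - x) = (2 + t) * (e y - e x) / t"
        using False by (simp add: nonzero_eq_divide_eq mult.commute)
      then have "(e x + e y) / 2 * (y - x) = (2 + t) * (e y - e x) / t / 2" by simp
      also have "\<dots> = (2 + t) / (2 * t) * e y - (2 + t) / (2 * t) * e x" using False by (simp add: field_simps)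
      finally show ?thesis .
    qed
    then show ?thesis using DA_if_primitive[of e "\<lambda>z. (2 + t) / (2 * t) * e z"] off by blast
  qed
  have eig: "f \<in> eigenspace (DA \<Lambda>) (Z_minus \<Lambda>) t \<longleftrightarrow> f = fun_scale (f 0) e" for f
  proof
    assume "f \<in> eigenspace (DA \<Lambda>) (Z_minus \<Lambda>) t"
    then have f: "f \<in> DA \<Lambda>" "Z_minus \<Lambda> f = fun_scale t f" by (auto simp: eigenspace_def)
    obtain g where g: "shift_rel g f" "\<And>z. z \<notin> verts \<Lambda> \<Longrightarrow> g z = 0"
      using Z_plus_surjective[OF f(1) zero_vertex] by metis
    \<comment> \<open>by surjectivity the description defining \<open>Z_minus\<close> is met\<close>
    have "shift_rel (fun_scale t f) f" using g(1) Z_minus_eq[OF g zero_vertex] f(2) by simp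
    then have fstep: "f b = f a * ((2 + t * (1 + b - a)) / (2 + t * (1 + a - b)))" if "(a, b) \<in> edges \<Lambda>" for a b
      using rel_iff[OF that, of f] shift_relD[OF _ that] by (simp add: fun_scale_def)
    have "f z = f 0 * e z" if "z \<in> verts \<Lambda>" for z
      using verts_connected[OF zero_vertex that]
    proof (induction rule: rtrancl_induct)
      case base show ?case using e0 by simp
    next
      case (step a b) then show ?case using fstep[OF step(2)] e_step[OF step(2)] by simp
    qed
    moreover have "f z = f 0 * e z" if "z \<notin> verts \<Lambda>" for z
      using DA_zero[OF f(1) that] off[OF that] by simp
    ultimately show "f = fun_scale (f 0) e" unfolding fun_scale_def by blast
  next
    assume "f = fun_scale (f 0) e"
    then obtain c where f: "f = fun_scale c e" by blast
    obtain \<Phi> where \<Phi>: "\<And>x y. (x, y) \<in> edges \<Lambda> \<Longrightarrow> (e x + e y) / 2 * (y - x) = \<Phi> y - \<Phi> x"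
      using DA_primitive[OF e_DA] by metis
    have "(f x + f y) / 2 * (y - x) = c * \<Phi> y - c * \<Phi> x" if "(x, y) \<in> edges \<Lambda>" for x y
      using arg_cong[OF \<Phi>[OF that], of "\<lambda>w. c * w"] by (simp add: f fun_scale_def algebra_simps)
    then have DA: "f \<in> DA \<Lambda>"
      using DA_if_primitive[of f "\<lambda>z. c * \<Phi> z"] off by (simp add: f fun_scale_def)
    have "shift_rel (fun_scale t f) f"
      unfolding shift_rel_def fun_scale_def
    proof (intro allI impI)
      fix a b assume "(a, b) \<in> edges \<Lambda>"
      then show "2 * (f b - f a) = t * f a - t * f b + (t * f a + t * f b) * (b - a)"
        using rel_iff[of a b f] e_step[of a b] by (simp add: f fun_scale_def)
    qed
    then have "Z_minus \<Lambda> f = fun_scale t f"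
      by (rule Z_minus_eq) (use DA_zero[OF DA] zero_vertex in \<open>auto simp: fun_scale_def\<close>)
    then show "f \<in> eigenspace (DA \<Lambda>) (Z_minus \<Lambda>) t" using DA by (simp add: eigenspace_def)
  qed
  have span: "eigenspace (DA \<Lambda>) (Z_minus \<Lambda>) t = cfun.span {e}"
  proof -
    have "f \<in> cfun.span {e} \<longleftrightarrow> f = fun_scale (f 0) e" for f
      unfolding cfun.span_singleton using e0 by (auto simp: fun_scale_def)
    then show ?thesis using eig by blast
  qed
  have enz: "e \<noteq> 0" using e0 by (metis zero_fun_def zero_neq_one)
  have dim: "cfun.dim (cfun.span {e}) = 1"
    using cfun.dim_span_eq_card_independent[of "{e}"] enz by (simp add: cfun.dependent_single)
  have "e \<in> eigenspace (DA \<Lambda>) (Z_minus \<Lambda>) t" unfolding span by (simp add: cfun.span_base)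
  then have "is_eigenvalue (DA \<Lambda>) (Z_minus \<Lambda>) t"
    using enz by (auto simp: is_eigenvalue_def eigenspace_def)
  then show ?thesis
    using span dim e_DA e0 along unfolding e_eq path_prod_def by simp
qed

end
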